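(* For a finite graph $G=(V,E)$ let ${\rm OPT}(G)$ be the optimal value (infimum) of the following program over vectors $\{{\bf v}_i: i\in\{0\}\cup V\}\subseteq\mathbb{R}^m$ ($m$ arbitrary): $$\text{minimize } \sum_{i\in V}\Big(1-\tfrac{\|{\bf v}_0-{\bf v}_i\|^2}{4}\Big)$$ subject to: $\|{\bf v}_i-{\bf v}_0\|^2+\|{\bf v}_j-{\bf v}_0\|^2=\|{\bf v}_i-{\bf v}_j\|^2$ for all $ij\in E$; $\|{\bf v}_i\|=1$ for all $i\in\{0\}\cup V$; and the pentagonal inequalities: for all $S,T\subseteq\{0\}\cup V$ with $|S|=2$, $|T|=3$, $$\sum_{i\in S,\,j\in T}\|{\bf v}_i-{\bf v}_j\|^2\ \ge\ \sum_{\{i,j\}\subseteq S}\|{\bf v}_i-{\bf v}_j\|^2+\sum_{\{i,j\}\subseteq T}\|{\bf v}_i-{\bf v}_j\|^2,$$ the sums on the right being over unordered pairs of distinct elements. Then for every $\epsilon>0$ there is a finite graph $G$ with ${\rm vc}(G)\ge(2-\epsilon)\,{\rm OPT}(G)$, where ${\rm vc}(G)$ is the size of a minimum vertex cover of $G$; i.e. the integrality gap is at least $2-\epsilon$. *)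

theory Defs
  imports "HOL-Analysis.Analysis"
begin

definition finite_graph :: "'a set \<Rightarrow> 'a set set \<Rightarrow> bool" where
  "finite_graph V E \<longleftrightarrow> finite V \<and> (\<forall>e\<in>E. e \<subseteq> V \<and> card e = 2)"

definition vertex_cover :: "'a set \<Rightarrow> 'a set set \<Rightarrow> 'a set \<Rightarrow> bool" where
  "vertex_cover V E C \<longleftrightarrow> C \<subseteq> V \<and> (\<forall>e\<in>E. e \<inter> C \<noteq> {})"

definition vc :: "'a set \<Rightarrow> 'a set set \<Rightarrow> nat" where
  "vc V E = Min {card C | C. vertex_cover V E C}"

text \<open>
  The dimension m varies inside the program, so a vector of m-dimensional Euclidean space is a
  function on nat of which only the coordinates below m are ever inspected. The index set
  consisting of 0 and the vertices is modelled by an option type, None being the index 0.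
\<close>

definition vnorm :: "nat \<Rightarrow> (nat \<Rightarrow> real) \<Rightarrow> real" where
  "vnorm m x = L2_set x {..<m}"

definition sqdist :: "nat \<Rightarrow> (nat \<Rightarrow> real) \<Rightarrow> (nat \<Rightarrow> real) \<Rightarrow> real" where
  "sqdist m x y = (vnorm m (\<lambda>k. x k - y k))\<^sup>2"

definition indices :: "'a set \<Rightarrow> 'a option set" where
  "indices V = insert None (Some ` V)"

text \<open>Each unordered pair of distinct elements is met twice as an ordered pair, hence the
  factor 1/2.\<close>

definition pair_sum :: "nat \<Rightarrow> ('i \<Rightarrow> nat \<Rightarrow> real) \<Rightarrow> 'i set \<Rightarrow> real" where
  "pair_sum m v S = (\<Sum>i\<in>S. \<Sum>j\<in>S - {i}. sqdist m (v i) (v j)) / 2"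

text \<open>The sets S and T below need not be disjoint; the overlapping case includes the triangle
  inequalities for squared distances.\<close>

definition pentagonal :: "nat \<Rightarrow> ('i \<Rightarrow> nat \<Rightarrow> real) \<Rightarrow> 'i set \<Rightarrow> bool" where
  "pentagonal m v I \<longleftrightarrow>
    (\<forall>S T. S \<subseteq> I \<and> T \<subseteq> I \<and> card S = 2 \<and> card T = 3 \<longrightarrow>
      (\<Sum>i\<in>S. \<Sum>j\<in>T. sqdist m (v i) (v j)) \<ge> pair_sum m v S + pair_sum m v T)"

definition feasible ::
  "'a set \<Rightarrow> 'a set set \<Rightarrow> nat \<Rightarrow> ('a option \<Rightarrow> nat \<Rightarrow> real) \<Rightarrow> bool" where
  "feasible V E m v \<longleftrightarrow>
    (\<forall>i j. {i, j} \<in> E \<longrightarrow>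
      sqdist m (v (Some i)) (v None) + sqdist m (v (Some j)) (v None)
        = sqdist m (v (Some i)) (v (Some j))) \<and>
    (\<forall>i\<in>indices V. vnorm m (v i) = 1) \<and>
    pentagonal m v (indices V)"

definition objective :: "'a set \<Rightarrow> nat \<Rightarrow> ('a option \<Rightarrow> nat \<Rightarrow> real) \<Rightarrow> real" where
  "objective V m v = (\<Sum>i\<in>V. 1 - sqdist m (v None) (v (Some i)) / 4)"

definition OPT :: "'a set \<Rightarrow> 'a set set \<Rightarrow> real" where
  "OPT V E = Inf {objective V m v | m v. feasible V E m v}"

text \<open>The next lemmas show that the minimum and the infimum above are taken over a finite
  nonempty set and over a nonempty set bounded below, respectively.\<close>

lemma vc_wf:
  assumes "finite_graph V E"
  shows "finite {card C | C. vertex_cover V E C}" "{card C | C. vertex_cover V E C} \<noteq> {}"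
proof -
  have "{card C | C. vertex_cover V E C} \<subseteq> card ` Pow V"
    by (auto simp: vertex_cover_def)
  moreover have "finite (card ` Pow V)"
    using assms by (simp add: finite_graph_def)
  ultimately show "finite {card C | C. vertex_cover V E C}"
    by (rule finite_subset)
  have "e \<inter> V \<noteq> {}" if "e \<in> E" for e
    using assms that by (fastforce simp: finite_graph_def Int_absorb2)
  then have "vertex_cover V E V"
    by (auto simp: vertex_cover_def)
  then show "{card C | C. vertex_cover V E C} \<noteq> {}"
    by blast
qed

lemma pair_sum_pair:
  assumes "a \<noteq> b"
  shows "pair_sum m v {a, b} = sqdist m (v a) (v b)"
proof -
  have "{a, b} - {a} = {b}" "{a, b} - {b} = {a}" using assms by auto
  moreover have "sqdist m (v b) (v a) = sqdist m (v a) (v b)"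
    by (simp add: sqdist_def vnorm_def L2_set_def power2_commute)
  ultimately show ?thesis
    using assms by (simp add: pair_sum_def)
qed

lemma OPT_nonempty: "{objective V m v | m v. feasible V E m v} \<noteq> {}"
proof -
  have "feasible V E 1 (\<lambda>_ _. 1)"
    by (simp add: feasible_def pentagonal_def pair_sum_def sqdist_def vnorm_def L2_set_def)
  then show ?thesis by blast
qed

lemma sqdist_le_4:
  assumes "vnorm m x = 1" "vnorm m y = 1"
  shows "sqdist m x y \<le> 4"
proof -
  have "vnorm m (\<lambda>k. x k + - y k) \<le> vnorm m x + vnorm m (\<lambda>k. - y k)"
    unfolding vnorm_def by (rule L2_set_triangle_ineq)
  also have "\<dots> = 2"
    using assms by (simp add: vnorm_def L2_set_def)
  finally have "vnorm m (\<lambda>k. x k - y k) \<le> 2" by simp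
  then have "(vnorm m (\<lambda>k. x k - y k))\<^sup>2 \<le> 2\<^sup>2"
    by (intro power_mono) (simp_all add: vnorm_def)
  then show ?thesis by (simp add: sqdist_def)
qed

lemma OPT_bdd_below: "bdd_below {objective V m v | m v. feasible V E m v}"
proof (rule bdd_belowI)
  fix x assume "x \<in> {objective V m v | m v. feasible V E m v}"
  then obtain m v where x: "x = objective V m v" and f: "feasible V E m v" by blast
  have "sqdist m (v None) (v (Some i)) \<le> 4" if "i \<in> V" for i
    using f that by (intro sqdist_le_4) (auto simp: feasible_def indices_def)
  then show "0 \<le> x"
    unfolding x objective_def by (intro sum_nonneg) simp
qed

end

theory Submission
  imports Defs "HOL-Computational_Algebra.Primes"
begin

text \<open>
  The graph has as vertices the subsets of {..<n} of even size, n = 2p + 2h with p an odd prime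
  and h a small but linear fraction of p, and joins two sets whose symmetric difference has 2p
  elements. By the Frankl--Wilson method modulo p an independent set has at most as many members as
  there are sets of size below p = n/2 - h, which by Chebyshev is a negligible fraction. Hence almost
  all vertices are needed in a cover.

  For the program, let u be the normalised sign vector of a set, and use the vectors
  (c, sqrt(1 - c^2) w) with w representing the kernel P(x) = (1 - \<beta>) x + \<beta> x^q, q even, where \<beta> is
  chosen so that P attains its minimum r, close to -1, at the inner product x of an edge. The
  objective is then card V / (1 - r), about half the number of vertices. Since tensor powers of sign
  vectors are sign vectors, the squared distances among vertices form a cut metric, which settles
  the inequalities not involving v0. Those with v0 in S amount to
  P(ab) + P(ac) + P(ad) - P(bc) - P(bd) - P(cd) \<le> 1 - r for sign vectors a, b, c, d.
\<close>

subsection \<open>Sets avoiding a Hamming distance\<close>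

text \<open>A multilinear polynomial of degree at most \<open>k\<close> in the 0/1 indicators of the
  elements of \<open>y\<close>, with integer coefficients so that it can later be reduced mod p. A
  square-free monomial is encoded by its set \<open>T\<close> of variables.\<close>

definition int_poly_deg :: "nat \<Rightarrow> nat \<Rightarrow> (nat set \<Rightarrow> int) \<Rightarrow> bool" where
  "int_poly_deg n k f \<longleftrightarrow>
    (\<exists>c. \<forall>y. f y = (\<Sum>T | T \<subseteq> {..<n} \<and> card T \<le> k. c T * of_bool (T \<subseteq> y)))"

lemma finite_subsets_card_le: "finite {T. T \<subseteq> {..<n::nat} \<and> card T \<le> k}"
  by (rule finite_subset[of _ "Pow {..<n}"]) auto

lemma int_poly_deg_monomial:
  assumes "T \<subseteq> {..<n}" "card T \<le> k"
  shows "int_poly_deg n k (\<lambda>y. of_bool (T \<subseteq> y))"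
  unfolding int_poly_deg_def
proof (intro exI[of _ "\<lambda>U. of_bool (U = T)"] allI)
  fix y
  have "(\<Sum>U | U \<subseteq> {..<n} \<and> card U \<le> k. of_bool (U = T) * of_bool (U \<subseteq> y))
      = (\<Sum>U | U \<subseteq> {..<n} \<and> card U \<le> k. if U = T then of_bool (T \<subseteq> y) else (0::int))"
    by (intro sum.cong) auto
  also have "\<dots> = of_bool (T \<subseteq> y)"
    using assms by (simp add: finite_subsets_card_le)
  finally show "of_bool (T \<subseteq> y) =
    (\<Sum>U | U \<subseteq> {..<n} \<and> card U \<le> k. of_bool (U = T) * of_bool (U \<subseteq> y) :: int)" by simp
qed

lemma int_poly_deg_add:
  assumes "int_poly_deg n k f" "int_poly_deg n k g"
  shows "int_poly_deg n k (\<lambda>y. f y + g y)"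
proof -
  obtain c d where "\<And>y. f y = (\<Sum>T | T \<subseteq> {..<n} \<and> card T \<le> k. c T * of_bool (T \<subseteq> y))"
    "\<And>y. g y = (\<Sum>T | T \<subseteq> {..<n} \<and> card T \<le> k. d T * of_bool (T \<subseteq> y))"
    using assms unfolding int_poly_deg_def by blast
  then show ?thesis
    unfolding int_poly_deg_def
    by (intro exI[of _ "\<lambda>T. c T + d T"]) (simp add: sum.distrib distrib_right)
qed

lemma int_poly_deg_cmult:
  assumes "int_poly_deg n k f"
  shows "int_poly_deg n k (\<lambda>y. a * f y)"
proof -
  obtain c where "\<And>y. f y = (\<Sum>T | T \<subseteq> {..<n} \<and> card T \<le> k. c T * of_bool (T \<subseteq> y))"
    using assms unfolding int_poly_deg_def by blast
  then show ?thesis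
    unfolding int_poly_deg_def
    by (intro exI[of _ "\<lambda>T. a * c T"]) (simp add: sum_distrib_left mult.assoc del: sum_mult_of_bool_eq sum_of_bool_mult_eq)
qed

lemma int_poly_deg_sum:
  assumes "finite I" "\<And>i. i \<in> I \<Longrightarrow> int_poly_deg n k (f i)"
  shows "int_poly_deg n k (\<lambda>y. \<Sum>i\<in>I. f i y)"
  using assms
proof (induction I rule: finite_induct)
  case empty
  show ?case using int_poly_deg_cmult[OF int_poly_deg_monomial[of "{}" n k], of 0] by simp
next
  case (insert i I)
  then show ?case by (simp add: int_poly_deg_add)
qed

text \<open>Indicators are idempotent, so multiplying the monomial of \<open>T\<close> by the
  indicator of \<open>j\<close> gives that of \<open>insert j T\<close>; products stay multilinear
  and the degree grows by at most one.\<close>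

lemma int_poly_deg_mult_linear:
  assumes "int_poly_deg n k f"
  shows "int_poly_deg n (Suc k) (\<lambda>y. (a + (\<Sum>j<n. b j * of_bool (j \<in> y))) * f y)"
proof -
  obtain c where c: "\<And>y. f y = (\<Sum>T | T \<subseteq> {..<n} \<and> card T \<le> k. c T * of_bool (T \<subseteq> y))"
    using assms unfolding int_poly_deg_def by blast
  have "card (insert j T) \<le> Suc k" if "card T \<le> k" for j :: nat and T
    using that by (metis card_insert_le_m1 diff_Suc_1 le_SucI nat_le_linear not_less_eq_eq zero_less_Suc)
  then have "int_poly_deg n (Suc k) (\<lambda>y. \<Sum>T | T \<subseteq> {..<n} \<and> card T \<le> k.
      (a * c T) * of_bool (T \<subseteq> y) + (\<Sum>j<n. (b j * c T) * of_bool (insert j T \<subseteq> y)))"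
    by (intro int_poly_deg_sum int_poly_deg_add int_poly_deg_cmult int_poly_deg_monomial)
      (auto intro: finite_subsets_card_le)
  moreover have "(a + (\<Sum>j<n. b j * of_bool (j \<in> y))) * f y = (\<Sum>T | T \<subseteq> {..<n} \<and> card T \<le> k.
      (a * c T) * of_bool (T \<subseteq> y) + (\<Sum>j<n. (b j * c T) * of_bool (insert j T \<subseteq> y)))" for y
  proof -
    have "(a + (\<Sum>j<n. b j * of_bool (j \<in> y))) * (c T * of_bool (T \<subseteq> y)) =
      (a * c T) * of_bool (T \<subseteq> y) + (\<Sum>j<n. (b j * c T) * of_bool (insert j T \<subseteq> y))" for T
      unfolding distrib_right sum_distrib_right
      by (intro arg_cong2[where f = "(+)"] sum.cong) auto
    then show ?thesis
      unfolding c sum_distrib_left by (intro sum.cong) auto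
  qed
  ultimately show ?thesis by presburger
qed

text \<open>An element of \<open>y\<close> raises the distance to \<open>a\<close> by one if it lies
  outside \<open>a\<close> and lowers it by one otherwise, so for fixed \<open>a\<close> the Hamming
  distance is affine in the indicators.\<close>

lemma card_sym_diff_affine:
  assumes "a \<subseteq> {..<n}" "y \<subseteq> {..<n::nat}"
  shows "int (card (sym_diff a y)) =
    int (card a) + (\<Sum>j<n. (1 - 2 * of_bool (j \<in> a)) * of_bool (j \<in> y))"
proof -
  have c: "int (card s) = (\<Sum>j<n. of_bool (j \<in> s))" if "s \<subseteq> {..<n}" for s
    using that by (simp add: Int_absorb1)
  have "sym_diff a y \<subseteq> {..<n}" using assms by auto
  then show ?thesis
    unfolding c[OF assms(1)] c[OF \<open>sym_diff a y \<subseteq> {..<n}\<close>] sum.distrib[symmetric]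
    by (intro sum.cong) auto
qed

lemma sym_diff_poly:
  fixes a :: "nat set"
  assumes "a \<subseteq> {..<n}"
  shows "\<exists>c. \<forall>y. y \<subseteq> {..<n} \<longrightarrow> (\<Prod>i\<in>{1..k}. int (card (sym_diff a y)) - int i)
    = (\<Sum>T | T \<subseteq> {..<n} \<and> card T \<le> k. c T * of_bool (T \<subseteq> y))"
proof -
  define l where "l y = int (card a) + (\<Sum>j<n. (1 - 2 * of_bool (j \<in> a)) * of_bool (j \<in> y))"
    for y :: "nat set"
  have "int_poly_deg n k (\<lambda>y. \<Prod>i\<in>{1..k}. l y - int i)"
  proof (induction k)
    case 0
    show ?case using int_poly_deg_monomial[of "{}" n 0] by simp
  next
    case (Suc k)
    from int_poly_deg_mult_linear[OF this, of "int (card a) - int (Suc k)" "\<lambda>j. 1 - 2 * of_bool (j \<in> a)"]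
    show ?case by (simp add: l_def algebra_simps)
  qed
  then show ?thesis
    using card_sym_diff_affine[OF assms] by (auto simp: int_poly_deg_def l_def)
qed

text \<open>The polynomial \<open>f a\<close> below vanishes mod \<open>p\<close> at every other
  member of \<open>A\<close>, where the distance has a residue in \<open>{1..p-1}\<close>, but not
  at \<open>a\<close>, where it is (p-1)! up to sign. So these polynomials are independent mod
  \<open>p\<close> in a space spanned by the monomials of degree below \<open>p\<close>.\<close>

lemma modular_frankl_wilson:
  fixes n p :: nat
  assumes p: "prime p" and A: "A \<subseteq> Pow {..<n}"
    and dist: "\<And>a b. a \<in> A \<Longrightarrow> b \<in> A \<Longrightarrow> a \<noteq> b \<Longrightarrow> \<not> p dvd card (sym_diff a b)"
  shows "card A \<le> card {T. T \<subseteq> {..<n} \<and> card T < p}"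
proof (rule ccontr)
  assume neg: "\<not> ?thesis"
  define L where "L = {T. T \<subseteq> {..<n} \<and> card T \<le> p - 1}"
  have p1: "p > 1" using p by (rule prime_gt_1_nat)
  have L: "{T. T \<subseteq> {..<n} \<and> card T < p} = L" "finite L"
    using p1 finite_subsets_card_le[of n "p - 1"] by (auto simp: L_def)
  have fA: "finite A" using A by (rule finite_subset) simp
  define f where "f a y = (\<Prod>i\<in>{1..p-1}. int (card (sym_diff a y)) - int i)" for a y :: "nat set"
  have "\<forall>a\<in>A. \<exists>c. \<forall>y. y \<subseteq> {..<n} \<longrightarrow> f a y = (\<Sum>T\<in>L. c T * of_bool (T \<subseteq> y))"
    unfolding f_def L_def using A by (intro ballI sym_diff_poly) auto
  then obtain c where c: "\<And>a y. a \<in> A \<Longrightarrow> y \<subseteq> {..<n} \<Longrightarrow> f a y = (\<Sum>T\<in>L. c a T * of_bool (T \<subseteq> y))"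
    by metis
  define Z where "Z = {0..<int p}"
  define \<phi> where "\<phi> z = (\<lambda>T\<in>L. (\<Sum>a\<in>A. z a * c a T) mod int p)" for z :: "nat set \<Rightarrow> int"
  \<comment> \<open>counting coefficient vectors mod p replaces linear independence over the field with p elements\<close>
  have "\<phi> ` (A \<rightarrow>\<^sub>E Z) \<subseteq> L \<rightarrow>\<^sub>E Z"
    using p1 by (auto simp: \<phi>_def Z_def)
  moreover have "card (L \<rightarrow>\<^sub>E Z) < card (A \<rightarrow>\<^sub>E Z)"
    using neg L fA p1 by (simp add: card_PiE Z_def)
  moreover have "finite (A \<rightarrow>\<^sub>E Z)" "finite (L \<rightarrow>\<^sub>E Z)"
    using fA L by (auto intro!: finite_PiE simp: Z_def)
  ultimately have "\<not> inj_on \<phi> (A \<rightarrow>\<^sub>E Z)"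
    by (metis card_inj_on_le not_le)
  then obtain z z' where z: "z \<in> A \<rightarrow>\<^sub>E Z" "z' \<in> A \<rightarrow>\<^sub>E Z" "\<phi> z = \<phi> z'" "z \<noteq> z'"
    by (auto simp: inj_on_def)
  \<comment> \<open>Two colliding vectors differ by a nontrivial linear relation mod
    \<open>p\<close> among the polynomials \<open>f a\<close>.\<close>
  have zero: "int p dvd (\<Sum>a\<in>A. (z a - z' a) * c a T)" if "T \<in> L" for T
  proof -
    have "(\<Sum>a\<in>A. z a * c a T) mod int p = (\<Sum>a\<in>A. z' a * c a T) mod int p"
      using fun_cong[OF z(3), of T] that by (simp add: \<phi>_def)
    then have "int p dvd (\<Sum>a\<in>A. z a * c a T) - (\<Sum>a\<in>A. z' a * c a T)"
      by (simp add: mod_eq_dvd_iff)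
    then show ?thesis by (simp add: sum_subtractf left_diff_distrib)
  qed
  have pp: "prime (int p)" using p by simp
  \<comment> \<open>Evaluated at \<open>b\<close>, the relation keeps only the term with
    \<open>f b b\<close>, which is invertible mod \<open>p\<close>. Hence \<open>z b\<close> and
    \<open>z' b\<close> are congruent, and both lie between 0 and p - 1.\<close>
  have "z b = z' b" if b: "b \<in> A" for b
  proof -
    have bn: "b \<subseteq> {..<n}" using b A by auto
    have "(\<Sum>a\<in>A. (z a - z' a) * f a b) = (\<Sum>a\<in>A. \<Sum>T\<in>L. (z a - z' a) * c a T * of_bool (T \<subseteq> b))"
      using bn by (simp add: c sum_distrib_left mult.assoc cong: sum.cong)
    also have "\<dots> = (\<Sum>T\<in>L. (\<Sum>a\<in>A. (z a - z' a) * c a T) * of_bool (T \<subseteq> b))"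
      by (subst sum.swap) (simp add: sum_distrib_right)
    finally have "int p dvd (\<Sum>a\<in>A. (z a - z' a) * f a b)"
      using zero by (auto intro!: dvd_sum)
    moreover have "int p dvd f a b" if a: "a \<in> A" "a \<noteq> b" for a
    proof -
      define d where "d = card (sym_diff a b)"
      have "\<not> p dvd d" using dist[OF a(1) b a(2)] by (simp add: d_def)
      then have "d mod p \<noteq> 0" "d mod p < p"
        using p1 by (auto simp: dvd_eq_mod_eq_0)
      then have r: "d mod p \<in> {1..p-1}" by auto
      have "int p dvd int d - int (d mod p)"
        by (simp add: zmod_int dvd_minus_mod)
      moreover have "int d - int (d mod p) dvd f a b"
        unfolding f_def d_def[symmetric] using r
        by (intro dvd_prodI[of _ _ "\<lambda>i. int d - int i"]) auto
      ultimately show ?thesis by (rule dvd_trans)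
    qed
    then have "int p dvd (\<Sum>a\<in>A - {b}. (z a - z' a) * f a b)"
      by (intro dvd_sum) auto
    ultimately have "int p dvd (z b - z' b) * f b b"
      using fA b by (simp add: sum.remove dvd_add_left_iff)
    moreover have "\<not> int p dvd f b b"
    proof
      assume "int p dvd f b b"
      then obtain i where i: "i \<in> {1..p-1}" "int p dvd int i"
        using pp by (auto simp: f_def prime_dvd_prod_iff)
      then have "p dvd i" by simp
      then show False using i(1) p1 by (auto dest!: dvd_imp_le)
    qed
    ultimately have "int p dvd z b - z' b"
      using pp prime_dvd_mult_iff by blast
    moreover have "z b \<in> Z" "z' b \<in> Z" using z b by auto
    ultimately show ?thesis
      by (simp add: Z_def) (metis mod_eq_dvd_iff mod_pos_pos_trivial)
  qed
  then have "z = z'" using z(1,2) by (metis PiE_ext)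
  then show False using z(4) by simp
qed

subsection \<open>Moments of subset sizes\<close>

lemma sum_Pow_lessThan_Suc:
  fixes f :: "nat set \<Rightarrow> 'a :: comm_monoid_add"
  shows "(\<Sum>T\<in>Pow {..<Suc n}. f T) = (\<Sum>T\<in>Pow {..<n}. f T) + (\<Sum>T\<in>Pow {..<n}. f (insert n T))"
proof -
  have "inj_on (insert n) (Pow {..<n})" by (auto simp: inj_on_def)
  then have "(\<Sum>T\<in>insert n ` Pow {..<n}. f T) = (\<Sum>T\<in>Pow {..<n}. f (insert n T))"
    by (simp add: sum.reindex)
  moreover have "Pow {..<Suc n} = Pow {..<n} \<union> insert n ` Pow {..<n}"
    by (simp add: lessThan_Suc Pow_insert)
  moreover have "Pow {..<n} \<inter> insert n ` Pow {..<n} = {}" by auto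
  ultimately show ?thesis by (simp add: sum.union_disjoint)
qed

lemma card_insert_lessThan:
  fixes n :: nat
  assumes "T \<in> Pow {..<n}"
  shows "card (insert n T) = Suc (card T)"
proof (rule card_insert_disjoint)
  show "finite T" using assms finite_subset by auto
qed (use assms in auto)

text \<open>The unnormalised second moment of a sum of \<open>n\<close> independent signs. A new
  element turns the deviation d into d - 1 or d + 1, and (d-1)^2 + (d+1)^2 = 2 d^2 + 2.\<close>

lemma sum_card_deviation_square:
  "(\<Sum>T\<in>Pow {..<n}. (real n - 2 * real (card T))\<^sup>2) = real n * 2 ^ n"
proof (induction n)
  case (Suc n)
  have "(\<Sum>T\<in>Pow {..<Suc n}. (real (Suc n) - 2 * real (card T))\<^sup>2)
    = (\<Sum>T\<in>Pow {..<n}. 2 * (real n - 2 * real (card T))\<^sup>2 + 2)"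
    unfolding sum_Pow_lessThan_Suc sum.distrib[symmetric]
    by (intro sum.cong) (auto simp: card_insert_lessThan power2_eq_square algebra_simps)
  then show ?case
    unfolding sum.distrib sum_distrib_left[symmetric] Suc.IH by (simp add: card_Pow algebra_simps)
qed simp

text \<open>Chebyshev's inequality: the sets counted deviate by more than \<open>n - 2 * p\<close>,
  which the hypothesis makes nonnegative, so that squaring preserves the order.\<close>

lemma card_few_elements_bound:
  assumes "2 * p \<le> n"
  shows "real (card {T. T \<subseteq> {..<n} \<and> card T < p}) * (real n - 2 * real p)\<^sup>2 \<le> real n * 2 ^ n"
proof -
  let ?L = "{T. T \<subseteq> {..<n} \<and> card T < p}"
  have "real (card ?L) * (real n - 2 * real p)\<^sup>2 = (\<Sum>T\<in>?L. (real n - 2 * real p)\<^sup>2)" by simp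
  also have "\<dots> \<le> (\<Sum>T\<in>?L. (real n - 2 * real (card T))\<^sup>2)"
    using assms by (intro sum_mono power_mono) auto
  also have "\<dots> \<le> (\<Sum>T\<in>Pow {..<n}. (real n - 2 * real (card T))\<^sup>2)"
    by (intro sum_mono2) auto
  finally show ?thesis by (simp add: sum_card_deviation_square)
qed

text \<open>Inserting the last element pairs even subsets with odd ones.\<close>

lemma sum_card_parity:
  fixes n :: nat
  assumes "n > 0"
  shows "(\<Sum>T\<in>Pow {..<n}. (-1) ^ card T) = (0::int)"
proof (cases n)
  case (Suc m)
  have "(\<Sum>T\<in>Pow {..<m}. (-1) ^ card (insert m T)) = (\<Sum>T\<in>Pow {..<m}. - ((-1) ^ card T) :: int)"
    by (intro sum.cong) (auto simp: card_insert_lessThan)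
  then show ?thesis by (simp add: Suc sum_Pow_lessThan_Suc sum_negf)
qed (use assms in simp)

lemma card_even_subsets:
  assumes "n > 0"
  shows "2 * card {T. T \<subseteq> {..<n::nat} \<and> even (card T)} = 2 ^ n"
proof -
  have "(\<Sum>T\<in>Pow {..<n}. (-1) ^ card T + (1::int)) = (\<Sum>T\<in>Pow {..<n}. if even (card T) then 2 else 0)"
    by (intro sum.cong) auto
  also have "\<dots> = 2 * int (card {T\<in>Pow {..<n}. even (card T)})"
    by (simp add: sum.If_cases Int_def)
  finally have "2 * int (card {T\<in>Pow {..<n}. even (card T)}) = 2 ^ n"
    using sum_card_parity[OF assms] by (simp add: sum.distrib card_Pow)
  then have "int (2 * card {T \<in> Pow {..<n}. even (card T)}) = int (2 ^ n)" by simp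
  then show ?thesis
    unfolding of_nat_eq_iff by simp
qed

subsection \<open>The kernel\<close>

text \<open>The weight \<beta> makes -m the critical point of the kernel, which is convex since q is even;
  Bernoulli's inequality is the tangent line there.\<close>

lemma kernel_min:
  fixes m \<beta> t :: real
  assumes q: "even q" "q > 0" and m: "m > 0" and \<beta>: "\<beta> = 1 / (1 + q * m ^ (q - 1))"
  shows "(1 - \<beta>) * (- m) + \<beta> * (- m) ^ q \<le> (1 - \<beta>) * t + \<beta> * t ^ q"
proof -
  define z where "z = - t / m - 1"
  have t: "- t = m * (1 + z)" using m by (simp add: z_def field_simps)
  have D: "1 + q * m ^ (q - 1) > 0" using m by (simp add: add_pos_nonneg)
  have mq: "m ^ q = m * m ^ (q - 1)" using q by (metis power_eq_if not_gr0)
  \<comment> \<open>This says that the derivative of the kernel vanishes at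
    \<open>-m\<close>.\<close>
  have b: "1 - \<beta> = \<beta> * (q * m ^ (q - 1))" using D by (simp add: \<beta> field_simps)
  have "\<beta> \<ge> 0" using D by (simp add: \<beta>)
  have "1 + q * z \<le> (1 + z) ^ q" by (rule Bernoulli_inequality_even[OF q(1)])
  then have "m ^ q * (1 + q * z) \<le> m ^ q * (1 + z) ^ q" using m by (intro mult_left_mono) auto
  also have "\<dots> = t ^ q" using t q(1) by (metis power_minus_even power_mult_distrib)
  finally have "\<beta> * (m ^ q * (1 + q * z)) \<le> \<beta> * t ^ q" using \<open>\<beta> \<ge> 0\<close> by (rule mult_left_mono)
  moreover have "(1 - \<beta>) * t = (1 - \<beta>) * (- m) - (1 - \<beta>) * m * z"
  proof -
    have "t = - m - m * z" using t by (simp add: algebra_simps)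
    then show ?thesis by (simp only:) (simp add: algebra_simps)
  qed
  moreover have "(1 - \<beta>) * m * z = \<beta> * (m ^ q * (q * z))" by (simp add: b mq)
  ultimately show ?thesis using q(1) by (simp add: distrib_left)
qed

text \<open>The third condition on \<open>m\<close> keeps \<open>m ^ (q - 1)\<close> above 1/2 by
  Bernoulli, so \<beta> is at most 2/q. The minimum is -m + \<beta> (m + m^q), which exceeds -1 by
  at most (1 - m) + 2 \<beta>.\<close>

lemma kernel_min_value:
  fixes m \<beta> :: real
  assumes q: "even q" "q > 0" and m: "0 < m" "m < 1" "2 * q * (1 - m) \<le> 1"
    and \<beta>: "\<beta> = 1 / (1 + q * m ^ (q - 1))"
  shows "0 < \<beta>" "\<beta> < 1" "(1 - \<beta>) * (- m) + \<beta> * (- m) ^ q \<le> 5 / q - 1"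
    "-1 < (1 - \<beta>) * (- m) + \<beta> * (- m) ^ q"
proof -
  have pos: "real q * m ^ (q - 1) > 0" using m q by simp
  show b: "0 < \<beta>" "\<beta> < 1" using pos by (auto simp: \<beta> divide_less_eq)
  have "1 + real (q - 1) * (m - 1) \<le> (1 + (m - 1)) ^ (q - 1)"
    using m by (intro Bernoulli_inequality) auto
  moreover have "real (q - 1) * (1 - m) \<le> real q * (1 - m)"
    using m by (intro mult_right_mono) auto
  ultimately have "m ^ (q - 1) \<ge> 1 / 2" using m(3) by (simp add: algebra_simps)
  then have "real q * m ^ (q - 1) \<ge> real q * (1/2)" by (intro mult_left_mono) auto
  then have "real q / 2 \<le> 1 + q * m ^ (q - 1)" by linarith
  then have "\<beta> \<le> 1 / (real q / 2)"
    unfolding \<beta> using q(2) pos by (intro divide_left_mono) (auto intro!: mult_pos_pos)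
  then have b2: "\<beta> \<le> 2 / q" by simp
  have m1: "1 - m \<le> 1 / q" using m q(2) by (simp add: field_simps)
  have "m ^ q \<le> 1" using m by (simp add: power_le_one)
  then have "\<beta> * m ^ q \<le> \<beta> * 1" using b by (intro mult_left_mono) auto
  moreover have "\<beta> * m \<le> \<beta> * 1" using b m by (intro mult_left_mono) auto
  ultimately show "(1 - \<beta>) * (- m) + \<beta> * (- m) ^ q \<le> 5 / q - 1"
    using b2 m1 q(1) by (simp add: algebra_simps)
  have "(1 - \<beta>) * m < 1 * 1" using b m by (intro mult_strict_mono) auto
  moreover have "\<beta> * m ^ q > 0" using b m by simp
  ultimately show "-1 < (1 - \<beta>) * (- m) + \<beta> * (- m) ^ q"
    using q(1) by simp
qed

subsection \<open>The inequality at the apex\<close>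

text \<open>For q samples that fall into three disjoint events of probabilities t1, t2, t3, let
  N1, N2, N3 be the numbers of hits. The sum is the expectation of the product of the nonnegative
  factors 1 + ei * (-1)^Ni; the induction removes one sample.\<close>

lemma parity_sum_nonneg:
  fixes t1 t2 t3 :: real
  assumes "t1 \<ge> 0" "t2 \<ge> 0" "t3 \<ge> 0" "t1 + t2 + t3 \<le> 1"
  shows "e1 \<in> {-1, 1} \<Longrightarrow> e2 \<in> {-1, 1} \<Longrightarrow> e3 \<in> {-1, 1} \<Longrightarrow>
    0 \<le> 1 + e1 * (1 - 2*t1)^q + e2 * (1 - 2*t2)^q + e3 * (1 - 2*t3)^q
      + e1 * e2 * (1 - 2*(t1+t2))^q + e1 * e3 * (1 - 2*(t1+t3))^q + e2 * e3 * (1 - 2*(t2+t3))^q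
      + e1 * e2 * e3 * (1 - 2*(t1+t2+t3))^q"
proof (induction q arbitrary: e1 e2 e3)
  case 0
  then show ?case by auto
next
  case (Suc q)
  define k1 k2 k3 k12 k13 k23 k where defs: "k1 = (1 - 2*t1)^q" "k2 = (1 - 2*t2)^q"
    "k3 = (1 - 2*t3)^q" "k12 = (1 - 2*(t1+t2))^q" "k13 = (1 - 2*(t1+t3))^q"
    "k23 = (1 - 2*(t2+t3))^q" "k = (1 - 2*(t1+t2+t3))^q"
  define g where "g d1 d2 d3 = 1 + d1 * k1 + d2 * k2 + d3 * k3 + d1 * d2 * k12 + d1 * d3 * k13
      + d2 * d3 * k23 + d1 * d2 * d3 * k" for d1 d2 d3 :: real
  have g: "0 \<le> g d1 d2 d3" if "d1 \<in> {-1, 1}" "d2 \<in> {-1, 1}" "d3 \<in> {-1, 1}" for d1 d2 d3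
    using Suc.IH[OF that] by (simp add: g_def defs)
  \<comment> \<open>Conditioning on the removed sample: with probability \<open>ti\<close> it hits
    event i and flips the sign \<open>ei\<close>; otherwise no sign changes.\<close>
  have "0 \<le> (1 - t1 - t2 - t3) * g e1 e2 e3 + t1 * g (-e1) e2 e3 + t2 * g e1 (-e2) e3
      + t3 * g e1 e2 (-e3)"
    using assms Suc.prems by (intro add_nonneg_nonneg mult_nonneg_nonneg g) auto
  also have "\<dots> = 1 + e1 * ((1 - 2*t1) * k1) + e2 * ((1 - 2*t2) * k2) + e3 * ((1 - 2*t3) * k3)
      + e1 * e2 * ((1 - 2*(t1+t2)) * k12) + e1 * e3 * ((1 - 2*(t1+t3)) * k13)
      + e2 * e3 * ((1 - 2*(t2+t3)) * k23) + e1 * e2 * e3 * ((1 - 2*(t1+t2+t3)) * k)"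
    by (simp add: g_def algebra_simps)
  finally show ?case
    by (simp add: defs)
qed

text \<open>All signs are negative in \<open>parity_sum_nonneg\<close>. This settles the vertices of
  the apex inequality at which the power terms do not cancel.\<close>

lemma third_difference:
  fixes t1 t2 t3 :: real
  assumes "t1 \<ge> 0" "t2 \<ge> 0" "t3 \<ge> 0" "t1 + t2 + t3 \<le> 1"
  shows "(1 - 2*t1)^q + (1 - 2*t2)^q + (1 - 2*t3)^q
      - (1 - 2*(t1+t2))^q - (1 - 2*(t1+t3))^q - (1 - 2*(t2+t3))^q
      \<le> 1 - (1 - 2*(t1+t2+t3))^q"
  using parity_sum_nonneg[OF assms, of "-1" "-1" "-1" q] by simp

lemma even_power_swap:
  fixes x y :: real
  assumes "even q" "x = y \<or> x = - y"
  shows "x ^ q = y ^ q"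
  using assms by auto

text \<open>For sign vectors a, b, c, d, let w0 be the fraction of coordinates where b, c, d agree, and
  w1, w2, w3 the fractions where only b, only c, only d deviates from the other two; let ui be the
  sum over the same coordinates of a times the majority of b, c, d. In terms of the ui, the
  correlations of a with b, c, d are the three bases in \<open>apex_pow\<close>, and \<open>apex_lin\<close> is their sum;
  the correlations among b, c, d are, up to sign, the three bases at (-w0, w1, w2, w3).
  Since even powers are convex in each ui, the required bound need only be checked at the vertices
  ui = wi or -wi.\<close>

definition apex_lin :: "real \<Rightarrow> real \<Rightarrow> real \<Rightarrow> real \<Rightarrow> real" where
  "apex_lin u0 u1 u2 u3 = 3 * u0 + u1 + u2 + u3"

definition apex_pow :: "nat \<Rightarrow> real \<Rightarrow> real \<Rightarrow> real \<Rightarrow> real \<Rightarrow> real" where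
  "apex_pow q u0 u1 u2 u3 = (u0 - u1 + u2 + u3)^q + (u0 + u1 - u2 + u3)^q + (u0 + u1 + u2 - u3)^q"

lemma apex_pow_minus: "even q \<Longrightarrow> apex_pow q (-u0) (-u1) (-u2) (-u3) = apex_pow q u0 u1 u2 u3"
  unfolding apex_pow_def by (intro arg_cong2[where f = "(+)"] even_power_swap) auto

text \<open>A single \<open>x\<close> controls both the linear and the power part, so that
  afterwards the lower bound on the kernel is needed at one point only.\<close>

lemma apex_vertex_pos:
  fixes w0 w1 w2 w3 :: real
  assumes w: "w0 \<ge> 0" "w1 \<ge> 0" "w2 \<ge> 0" "w3 \<ge> 0" "w0 + w1 + w2 + w3 = 1" and q: "even q"
    and u: "u1 = w1 \<or> u1 = -w1" "u2 = w2 \<or> u2 = -w2" "u3 = w3 \<or> u3 = -w3"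
  shows "\<exists>x. \<bar>x\<bar> \<le> 1 \<and> \<bar>apex_lin w0 u1 u2 u3\<bar> \<le> 4 * w0 + \<bar>x\<bar> \<and>
    apex_pow q w0 u1 u2 u3 - apex_pow q (-w0) w1 w2 w3 \<le> 1 - x^q"
proof -
  note sw = even_power_swap[OF q]
  \<comment> \<open>Powers of the correlations among b, c, d, each in two forms: 1 - 2s and 1 -
    2(1-s) are opposite, and the cases below use whichever form fits.\<close>
  have k1: "(-w0 - w1 + w2 + w3)^q = (1 - 2*(w0+w1))^q" "(-w0 - w1 + w2 + w3)^q = (1 - 2*(w2+w3))^q"
    using w by - (rule sw, argo)+
  have k2: "(-w0 + w1 - w2 + w3)^q = (1 - 2*(w0+w2))^q" "(-w0 + w1 - w2 + w3)^q = (1 - 2*(w1+w3))^q"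
    using w by - (rule sw, argo)+
  have k3: "(-w0 + w1 + w2 - w3)^q = (1 - 2*(w0+w3))^q" "(-w0 + w1 + w2 - w3)^q = (1 - 2*(w1+w2))^q"
    using w by - (rule sw, argo)+
  \<comment> \<open>No minus sign: \<open>a\<close> is the majority of b, c, d, and \<open>x\<close>
    is, up to sign, the base belonging to \<open>w1 + w2 + w3\<close> in the third difference. With
    two minus signs \<open>w0\<close> exchanges roles with one \<open>wi\<close>.\<close>
  have ?thesis if u': "u1 = w1" "u2 = w2" "u3 = w3"
  proof (intro exI[of _ "1 - 2*w0"] conjI)
    show "\<bar>1 - 2*w0\<bar> \<le> 1" "\<bar>apex_lin w0 u1 u2 u3\<bar> \<le> 4 * w0 + \<bar>1 - 2*w0\<bar>"
      using w u' unfolding apex_lin_def by - argo+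
    have "(w0 - u1 + u2 + u3)^q = (1 - 2*w1)^q" "(w0 + u1 - u2 + u3)^q = (1 - 2*w2)^q" "(w0 + u1 + u2 - u3)^q = (1 - 2*w3)^q"
      using w u' by - (rule sw, argo)+
    then show "apex_pow q w0 u1 u2 u3 - apex_pow q (-w0) w1 w2 w3 \<le> 1 - (1 - 2*w0)^q"
      unfolding apex_pow_def using third_difference[of w1 w2 w3 q] w k1(2) k2(2) k3(2)
        sw[of "1 - 2*(w1+w2+w3)" "1 - 2*w0"] by simp
  qed
  moreover
  \<comment> \<open>One minus sign: \<open>a\<close> coincides with one of b, c, d, here d. Its
    correlation with itself is 1, two further power terms cancel, and \<open>x\<close> is up to sign
    the correlation of the other two vectors.\<close>
  have ?thesis if u': "u1 = w1" "u2 = w2" "u3 = -w3"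
  proof (intro exI[of _ "1 - 2*(w0+w3)"] conjI)
    show "\<bar>1 - 2*(w0+w3)\<bar> \<le> 1" "\<bar>apex_lin w0 u1 u2 u3\<bar> \<le> 4 * w0 + \<bar>1 - 2*(w0+w3)\<bar>"
      using w u' unfolding apex_lin_def by - argo+
    have "(w0 - u1 + u2 + u3)^q = (-w0 + w1 - w2 + w3)^q" "(w0 + u1 - u2 + u3)^q = (-w0 - w1 + w2 + w3)^q" "(w0 + u1 + u2 - u3)^q = 1^q"
      using w u' by - (rule sw, argo)+
    then show "apex_pow q w0 u1 u2 u3 - apex_pow q (-w0) w1 w2 w3 \<le> 1 - (1 - 2*(w0+w3))^q"
      unfolding apex_pow_def using k3 by simp
  qed
  moreover
  have ?thesis if u': "u1 = w1" "u2 = -w2" "u3 = w3"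
  proof (intro exI[of _ "1 - 2*(w0+w2)"] conjI)
    show "\<bar>1 - 2*(w0+w2)\<bar> \<le> 1" "\<bar>apex_lin w0 u1 u2 u3\<bar> \<le> 4 * w0 + \<bar>1 - 2*(w0+w2)\<bar>"
      using w u' unfolding apex_lin_def by - argo+
    have "(w0 - u1 + u2 + u3)^q = (-w0 + w1 + w2 - w3)^q" "(w0 + u1 - u2 + u3)^q = 1^q" "(w0 + u1 + u2 - u3)^q = (-w0 - w1 + w2 + w3)^q"
      using w u' by - (rule sw, argo)+
    then show "apex_pow q w0 u1 u2 u3 - apex_pow q (-w0) w1 w2 w3 \<le> 1 - (1 - 2*(w0+w2))^q"
      unfolding apex_pow_def using k2 by simp
  qed
  moreover
  have ?thesis if u': "u1 = w1" "u2 = -w2" "u3 = -w3"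
  proof (intro exI[of _ "1 - 2*w1"] conjI)
    show "\<bar>1 - 2*w1\<bar> \<le> 1" "\<bar>apex_lin w0 u1 u2 u3\<bar> \<le> 4 * w0 + \<bar>1 - 2*w1\<bar>"
      using w u' unfolding apex_lin_def by - argo+
    have "(w0 - u1 + u2 + u3)^q = (1 - 2*w0)^q" "(w0 + u1 - u2 + u3)^q = (1 - 2*w3)^q" "(w0 + u1 + u2 - u3)^q = (1 - 2*w2)^q"
      using w u' by - (rule sw, argo)+
    then show "apex_pow q w0 u1 u2 u3 - apex_pow q (-w0) w1 w2 w3 \<le> 1 - (1 - 2*w1)^q"
      unfolding apex_pow_def using third_difference[of w0 w2 w3 q] w k1(2) k2(1) k3(1)
        sw[of "1 - 2*(w0+w2+w3)" "1 - 2*w1"] by simp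
  qed
  moreover
  have ?thesis if u': "u1 = -w1" "u2 = w2" "u3 = w3"
  proof (intro exI[of _ "1 - 2*(w0+w1)"] conjI)
    show "\<bar>1 - 2*(w0+w1)\<bar> \<le> 1" "\<bar>apex_lin w0 u1 u2 u3\<bar> \<le> 4 * w0 + \<bar>1 - 2*(w0+w1)\<bar>"
      using w u' unfolding apex_lin_def by - argo+
    have "(w0 - u1 + u2 + u3)^q = 1^q" "(w0 + u1 - u2 + u3)^q = (-w0 + w1 + w2 - w3)^q" "(w0 + u1 + u2 - u3)^q = (-w0 + w1 - w2 + w3)^q"
      using w u' by - (rule sw, argo)+
    then show "apex_pow q w0 u1 u2 u3 - apex_pow q (-w0) w1 w2 w3 \<le> 1 - (1 - 2*(w0+w1))^q"
      unfolding apex_pow_def using k1 by simp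
  qed
  moreover
  have ?thesis if u': "u1 = -w1" "u2 = w2" "u3 = -w3"
  proof (intro exI[of _ "1 - 2*w2"] conjI)
    show "\<bar>1 - 2*w2\<bar> \<le> 1" "\<bar>apex_lin w0 u1 u2 u3\<bar> \<le> 4 * w0 + \<bar>1 - 2*w2\<bar>"
      using w u' unfolding apex_lin_def by - argo+
    have "(w0 - u1 + u2 + u3)^q = (1 - 2*w3)^q" "(w0 + u1 - u2 + u3)^q = (1 - 2*w0)^q" "(w0 + u1 + u2 - u3)^q = (1 - 2*w1)^q"
      using w u' by - (rule sw, argo)+
    then show "apex_pow q w0 u1 u2 u3 - apex_pow q (-w0) w1 w2 w3 \<le> 1 - (1 - 2*w2)^q"
      unfolding apex_pow_def using third_difference[of w0 w1 w3 q] w k2(2) k1(1) k3(1)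
        sw[of "1 - 2*(w0+w1+w3)" "1 - 2*w2"] by simp
  qed
  moreover
  have ?thesis if u': "u1 = -w1" "u2 = -w2" "u3 = w3"
  proof (intro exI[of _ "1 - 2*w3"] conjI)
    show "\<bar>1 - 2*w3\<bar> \<le> 1" "\<bar>apex_lin w0 u1 u2 u3\<bar> \<le> 4 * w0 + \<bar>1 - 2*w3\<bar>"
      using w u' unfolding apex_lin_def by - argo+
    have "(w0 - u1 + u2 + u3)^q = (1 - 2*w2)^q" "(w0 + u1 - u2 + u3)^q = (1 - 2*w1)^q" "(w0 + u1 + u2 - u3)^q = (1 - 2*w0)^q"
      using w u' by - (rule sw, argo)+
    then show "apex_pow q w0 u1 u2 u3 - apex_pow q (-w0) w1 w2 w3 \<le> 1 - (1 - 2*w3)^q"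
      unfolding apex_pow_def using third_difference[of w0 w1 w2 q] w k3(2) k1(1) k2(1)
        sw[of "1 - 2*(w0+w1+w2)" "1 - 2*w3"] by simp
  qed
  moreover
  \<comment> \<open>Three minus signs: \<open>a\<close> is the product of b, c, d, so its
    correlation with one of them is that of the other two, and all power terms cancel.\<close>
  have ?thesis if u': "u1 = -w1" "u2 = -w2" "u3 = -w3"
  proof (intro exI[of _ "1"] conjI)
    show "\<bar>1::real\<bar> \<le> 1" "\<bar>apex_lin w0 u1 u2 u3\<bar> \<le> 4 * w0 + \<bar>1\<bar>"
      using w u' by (auto simp: apex_lin_def)
    have "(w0 - u1 + u2 + u3)^q = (-w0 - w1 + w2 + w3)^q" "(w0 + u1 - u2 + u3)^q = (-w0 + w1 - w2 + w3)^q" "(w0 + u1 + u2 - u3)^q = (-w0 + w1 + w2 - w3)^q"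
      using w u' by - (rule sw, argo)+
    then show "apex_pow q w0 u1 u2 u3 - apex_pow q (-w0) w1 w2 w3 \<le> 1 - (1)^q"
      unfolding apex_pow_def using w by simp
  qed
  ultimately show ?thesis using u by metis
qed

text \<open>Negating all four \<open>ui\<close> reduces \<open>u0 = -w0\<close> to
  \<open>u0 = w0\<close>: even powers are unchanged, and the linear part changes sign, which the
  absolute value in \<open>apex_vertex_pos\<close> allows.\<close>

lemma apex_vertex:
  fixes w0 w1 w2 w3 \<alpha> \<beta> r :: real
  assumes w: "w0 \<ge> 0" "w1 \<ge> 0" "w2 \<ge> 0" "w3 \<ge> 0" "w0 + w1 + w2 + w3 = 1" and q: "even q"
    and u: "u0 = w0 \<or> u0 = -w0" "u1 = w1 \<or> u1 = -w1" "u2 = w2 \<or> u2 = -w2" "u3 = w3 \<or> u3 = -w3"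
    and ab: "\<alpha> \<ge> 0" "\<beta> \<ge> 0" "\<alpha> + \<beta> = 1"
    and r: "\<And>t. \<bar>t\<bar> \<le> 1 \<Longrightarrow> r \<le> \<alpha> * t + \<beta> * t^q"
  shows "\<alpha> * (apex_lin u0 u1 u2 u3 + 1 - 4 * w0)
    + \<beta> * (apex_pow q u0 u1 u2 u3 - apex_pow q (-w0) w1 w2 w3) \<le> 1 - r"
proof -
  have "\<exists>x. \<bar>x\<bar> \<le> 1 \<and> apex_lin u0 u1 u2 u3 \<le> 4 * w0 + \<bar>x\<bar> \<and>
    apex_pow q u0 u1 u2 u3 - apex_pow q (-w0) w1 w2 w3 \<le> 1 - x^q"
  proof (cases "u0 = w0")
    case True
    then show ?thesis
      using apex_vertex_pos[OF w q u(2-4)] by (meson abs_le_D1)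
  next
    case False
    then have "u0 = - w0" using u by simp
    moreover have "-u1 = w1 \<or> -u1 = -w1" "-u2 = w2 \<or> -u2 = -w2" "-u3 = w3 \<or> -u3 = -w3"
      using u by auto
    note apex_vertex_pos[OF w q this]
    moreover have "apex_lin (-w0) u1 u2 u3 \<le> \<bar>apex_lin w0 (-u1) (-u2) (-u3)\<bar>"
      by (simp add: apex_lin_def)
    moreover have "apex_pow q w0 (-u1) (-u2) (-u3) = apex_pow q (-w0) u1 u2 u3"
      using apex_pow_minus[OF q, of w0 "-u1" "-u2" "-u3"] by simp
    ultimately show ?thesis by (metis order_trans)
  qed
  then obtain x where x: "\<bar>x\<bar> \<le> 1" "apex_lin u0 u1 u2 u3 \<le> 4 * w0 + \<bar>x\<bar>"
    "apex_pow q u0 u1 u2 u3 - apex_pow q (-w0) w1 w2 w3 \<le> 1 - x^q" by blast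
  have "\<alpha> * (apex_lin u0 u1 u2 u3 + 1 - 4 * w0) \<le> \<alpha> * (1 + \<bar>x\<bar>)"
    using x ab by (intro mult_left_mono) auto
  moreover have "\<beta> * (apex_pow q u0 u1 u2 u3 - apex_pow q (-w0) w1 w2 w3) \<le> \<beta> * (1 - x^q)"
    using x ab by (intro mult_left_mono) auto
  \<comment> \<open>The two bounds add up to 1 minus the kernel at \<open>-\<bar>x\<bar>\<close>;
    the even power does not see the sign.\<close>
  moreover have "r \<le> \<alpha> * (- \<bar>x\<bar>) + \<beta> * x^q"
    using r[of "- \<bar>x\<bar>"] x q by (simp add: power_even_abs)
  moreover have "\<alpha> * (1 + \<bar>x\<bar>) + \<beta> * (1 - x^q) = 1 - (\<alpha> * (- \<bar>x\<bar>) + \<beta> * x^q)"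
    using ab(3) by (simp add: algebra_simps)
  ultimately show ?thesis by linarith
qed

section \<open>Convexity: from the vertices to all admissible u\<close>

lemma convex_on_symmetric_interval:
  fixes f :: "real \<Rightarrow> real"
  assumes "convex_on UNIV f" "\<bar>u\<bar> \<le> w" "f w \<le> R" "f (-w) \<le> R"
  shows "f u \<le> R"
proof (cases "w = 0")
  case True
  then show ?thesis using assms by auto
next
  case False
  define t where "t = (u + w) / (2 * w)"
  have t: "0 \<le> t" "t \<le> 1" using assms(2) False by (auto simp: t_def field_simps)
  have "u = (1 - t) * (-w) + t * w" using False by (simp add: t_def field_simps)
  then have "f u \<le> (1 - t) * f (-w) + t * f w"
    using convex_onD[OF assms(1) t, of "-w" w] by simp
  also have "\<dots> \<le> (1 - t) * R + t * R"
    using assms t by (intro add_mono mult_left_mono) auto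
  finally show ?thesis by (simp add: algebra_simps)
qed

lemma convex_on_affine_even_power:
  fixes c d :: real
  assumes "even q"
  shows "convex_on UNIV (\<lambda>u. (c + d * u) ^ q)"
proof (rule convex_onI)
  fix t x y :: real
  assume t: "0 < t" "t < 1"
  have "c + d * ((1 - t) *\<^sub>R x + t *\<^sub>R y) = (1 - t) * (c + d * x) + t * (c + d * y)"
    by (simp add: algebra_simps)
  then show "(c + d * ((1 - t) *\<^sub>R x + t *\<^sub>R y)) ^ q \<le> (1 - t) * (c + d * x) ^ q + t * (c + d * y) ^ q"
    using convex_onD[OF convex_power_even[OF assms], of t "c + d * x" "c + d * y"] t by simp
qed simp

lemma convex_on_affine:
  fixes c d :: real
  shows "convex_on UNIV (\<lambda>u. c + d * u)"
  by (rule convex_onI) (simp_all add: algebra_simps)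

lemma convex_on_affine_plus_even_powers:
  fixes a b \<beta> :: real
  assumes "even q" "\<beta> \<ge> 0" "\<And>u. f u = (a + b * u) + \<beta> * ((c1 + d1 * u)^q + (c2 + d2 * u)^q + (c3 + d3 * u)^q)"
  shows "convex_on UNIV f"
proof -
  have "f = (\<lambda>u. (a + b * u) + \<beta> * ((c1 + d1 * u)^q + (c2 + d2 * u)^q + (c3 + d3 * u)^q))"
    using assms(3) by blast
  then show ?thesis
    using assms(1,2) by (auto intro!: convex_on_add convex_on_cmul convex_on_affine convex_on_affine_even_power)
qed

lemma apex_bound:
  fixes w0 w1 w2 w3 \<alpha> \<beta> r :: real
  assumes w: "w0 + w1 + w2 + w3 = 1" and q: "even q"
    and u: "\<bar>u0\<bar> \<le> w0" "\<bar>u1\<bar> \<le> w1" "\<bar>u2\<bar> \<le> w2" "\<bar>u3\<bar> \<le> w3"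
    and ab: "\<alpha> \<ge> 0" "\<beta> \<ge> 0" "\<alpha> + \<beta> = 1"
    and r: "\<And>t. \<bar>t\<bar> \<le> 1 \<Longrightarrow> r \<le> \<alpha> * t + \<beta> * t^q"
  shows "\<alpha> * (apex_lin u0 u1 u2 u3 + 1 - 4 * w0)
    + \<beta> * (apex_pow q u0 u1 u2 u3 - apex_pow q (-w0) w1 w2 w3) \<le> 1 - r"
proof -
  define F where "F u0 u1 u2 u3 = \<alpha> * (apex_lin u0 u1 u2 u3 + 1 - 4 * w0)
    + \<beta> * (apex_pow q u0 u1 u2 u3 - apex_pow q (-w0) w1 w2 w3)" for u0 u1 u2 u3
  let ?K = "\<alpha> * (1 - 4 * w0) - \<beta> * apex_pow q (-w0) w1 w2 w3"
  have c0: "convex_on UNIV (\<lambda>u. F u y1 y2 y3)" for y1 y2 y3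
    by (rule convex_on_affine_plus_even_powers[OF q ab(2), where a = "?K + \<alpha> * (y1 + y2 + y3)" and b = "3 * \<alpha>"
        and ?c1.0 = "- y1 + y2 + y3" and ?c2.0 = "y1 - y2 + y3" and ?c3.0 = "y1 + y2 - y3"
        and ?d1.0 = 1 and ?d2.0 = 1 and ?d3.0 = 1])
      (simp add: F_def apex_lin_def apex_pow_def algebra_simps)
  have c1: "convex_on UNIV (\<lambda>u. F y0 u y2 y3)" for y0 y2 y3
    by (rule convex_on_affine_plus_even_powers[OF q ab(2), where a = "?K + \<alpha> * (3 * y0 + y2 + y3)" and b = "\<alpha>"
        and ?c1.0 = "y0 + y2 + y3" and ?c2.0 = "y0 - y2 + y3" and ?c3.0 = "y0 + y2 - y3"
        and ?d1.0 = "-1" and ?d2.0 = 1 and ?d3.0 = 1])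
      (simp add: F_def apex_lin_def apex_pow_def algebra_simps)
  have c2: "convex_on UNIV (\<lambda>u. F y0 y1 u y3)" for y0 y1 y3
    by (rule convex_on_affine_plus_even_powers[OF q ab(2), where a = "?K + \<alpha> * (3 * y0 + y1 + y3)" and b = "\<alpha>"
        and ?c1.0 = "y0 - y1 + y3" and ?c2.0 = "y0 + y1 + y3" and ?c3.0 = "y0 + y1 - y3"
        and ?d1.0 = "1" and ?d2.0 = "-1" and ?d3.0 = 1])
      (simp add: F_def apex_lin_def apex_pow_def algebra_simps)
  have c3: "convex_on UNIV (\<lambda>u. F y0 y1 y2 u)" for y0 y1 y2
    by (rule convex_on_affine_plus_even_powers[OF q ab(2), where a = "?K + \<alpha> * (3 * y0 + y1 + y2)" and b = "\<alpha>"
        and ?c1.0 = "y0 - y1 + y2" and ?c2.0 = "y0 + y1 - y2" and ?c3.0 = "y0 + y1 + y2"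
        and ?d1.0 = "1" and ?d2.0 = 1 and ?d3.0 = "-1"])
      (simp add: F_def apex_lin_def apex_pow_def algebra_simps)
  \<comment> \<open>The variables leave the vertices one at a time, \<open>u3\<close> first, so
    convexity in each variable separately suffices.\<close>
  have "F v0 v1 v2 v3 \<le> 1 - r" if "v0 = w0 \<or> v0 = -w0" "v1 = w1 \<or> v1 = -w1" "v2 = w2 \<or> v2 = -w2"
      "v3 = w3 \<or> v3 = -w3" for v0 v1 v2 v3
    unfolding F_def using u by (intro apex_vertex[OF _ _ _ _ w q that ab r]) auto
  then have "F v0 v1 v2 u3 \<le> 1 - r" if "v0 = w0 \<or> v0 = -w0" "v1 = w1 \<or> v1 = -w1" "v2 = w2 \<or> v2 = -w2"
      for v0 v1 v2
    using that u by (intro convex_on_symmetric_interval[OF c3 u(4)]) auto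
  then have "F v0 v1 u2 u3 \<le> 1 - r" if "v0 = w0 \<or> v0 = -w0" "v1 = w1 \<or> v1 = -w1" for v0 v1
    using that u by (intro convex_on_symmetric_interval[OF c2 u(3)]) auto
  then have "F v0 u1 u2 u3 \<le> 1 - r" if "v0 = w0 \<or> v0 = -w0" for v0
    using that u by (intro convex_on_symmetric_interval[OF c1 u(2)]) auto
  then have "F u0 u1 u2 u3 \<le> 1 - r"
    by (intro convex_on_symmetric_interval[OF c0 u(1)]) auto
  then show ?thesis by (simp add: F_def)
qed

subsection \<open>Sign vectors and the semidefinite solution\<close>

definition corr :: "nat \<Rightarrow> (nat \<Rightarrow> real) \<Rightarrow> (nat \<Rightarrow> real) \<Rightarrow> real" where
  "corr n x y = (\<Sum>k<n. x k * y k) / real n"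

definition sign_vec :: "nat \<Rightarrow> (nat \<Rightarrow> real) \<Rightarrow> bool" where
  "sign_vec n x \<longleftrightarrow> (\<forall>k<n. x k = 1 \<or> x k = -1)"

text \<open>An index below \<open>N * n\<close> encodes the pair of its quotient and remainder by
  \<open>n\<close>, so these are tensor products of vectors.\<close>

lemma corr_tensor:
  assumes "n > 0"
  shows "corr (N * n) (\<lambda>k. x (k div n) * z (k mod n)) (\<lambda>k. x' (k div n) * z' (k mod n))
    = corr N x x' * corr n z z'"
proof -
  let ?f = "\<lambda>k. x (k div n) * z (k mod n) * (x' (k div n) * z' (k mod n))"
  have "(\<Sum>k<N * n. ?f k) = (\<Sum>i<N. sum ?f {i * n..<i * n + n})"
    by (rule sum.nat_group[symmetric])
  also have "\<dots> = (\<Sum>i<N. (x i * x' i) * (\<Sum>k<n. z k * z' k))"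
  proof (rule sum.cong[OF refl])
    fix i
    have "sum ?f {i * n..<i * n + n} = (\<Sum>k\<in>{0..<n}. ?f (k + i * n))"
      using sum.shift_bounds_nat_ivl[of ?f 0 "i * n" n] by (simp add: add.commute)
    also have "\<dots> = (\<Sum>k<n. (x i * x' i) * (z k * z' k))"
      using assms by (intro sum.cong) (auto simp: mult_ac)
    finally show "sum ?f {i * n..<i * n + n} = (x i * x' i) * (\<Sum>k<n. z k * z' k)"
      by (simp add: sum_distrib_left)
  qed
  also have "\<dots> = (\<Sum>i<N. x i * x' i) * (\<Sum>k<n. z k * z' k)"
    by (simp add: sum_distrib_right)
  finally show ?thesis by (simp add: corr_def)
qed

text \<open>Tensor powers of sign vectors have entries 1 and -1 again, so inequalities for sign
  vectors also apply to powers of correlations.\<close>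

lemma corr_power:
  fixes x :: "'a \<Rightarrow> nat \<Rightarrow> real"
  assumes "n > 0" "\<And>i. sign_vec n (x i)"
  obtains N y where "N > 0" "\<And>i. sign_vec N (y i)" "\<And>i j. corr N (y i) (y j) = corr n (x i) (x j) ^ q"
proof -
  have "\<exists>N y. N > 0 \<and> (\<forall>i. sign_vec N (y i)) \<and> (\<forall>i j. corr N (y i) (y j) = corr n (x i) (x j) ^ q)"
  proof (induction q)
    case 0
    show ?case by (intro exI[of _ 1] exI[of _ "\<lambda>_ _. 1"]) (simp add: sign_vec_def corr_def)
  next
    case (Suc q)
    then obtain N and y where Ny: "N > 0" "\<And>i. sign_vec N (y i)"
      "\<And>i j. corr N (y i) (y j) = corr n (x i) (x j) ^ q" by auto
    have "sign_vec (N * n) (\<lambda>k. y i (k div n) * x i (k mod n))" for i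
      unfolding sign_vec_def
    proof (intro allI impI)
      fix k assume "k < N * n"
      then have "k div n < N" "k mod n < n"
        using assms(1) by (auto simp: less_mult_imp_div_less)
      then show "y i (k div n) * x i (k mod n) = 1 \<or> y i (k div n) * x i (k mod n) = - 1"
        using Ny(2)[of i] assms(2)[of i] unfolding sign_vec_def by (metis mult_1 mult_minus1 minus_minus)
    qed
    then show ?case
      using Ny assms(1)
      by (intro exI[of _ "N * n"] exI[of _ "\<lambda>i k. y i (k div n) * x i (k mod n)"])
        (auto simp: corr_tensor)
  qed
  then show thesis using that by blast
qed

text \<open>In each coordinate s + s' - t1 - t2 - t3 is an odd integer, so its square is at least 1;
  expanding the square gives the inequality.\<close>

lemma corr_pentagonal:
  assumes s: "sign_vec n s" "sign_vec n s'" "sign_vec n t1" "sign_vec n t2" "sign_vec n t3" and n: "n > 0"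
  shows "corr n s t1 + corr n s t2 + corr n s t3 + corr n s' t1 + corr n s' t2 + corr n s' t3
    \<le> 2 + corr n s s' + corr n t1 t2 + corr n t1 t3 + corr n t2 t3"
proof -
  have "(\<Sum>k<n. s k * t1 k + s k * t2 k + s k * t3 k + s' k * t1 k + s' k * t2 k + s' k * t3 k)
    \<le> (\<Sum>k<n. 2 + s k * s' k + t1 k * t2 k + t1 k * t3 k + t2 k * t3 k)"
  proof (rule sum_mono)
    fix k assume "k \<in> {..<n}"
    then have "s k = 1 \<or> s k = -1" "s' k = 1 \<or> s' k = -1" "t1 k = 1 \<or> t1 k = -1" "t2 k = 1 \<or> t2 k = -1"
      "t3 k = 1 \<or> t3 k = -1"
      using s by (auto simp: sign_vec_def)
    then show "s k * t1 k + s k * t2 k + s k * t3 k + s' k * t1 k + s' k * t2 k + s' k * t3 k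
      \<le> 2 + s k * s' k + t1 k * t2 k + t1 k * t3 k + t2 k * t3 k"
      by (elim disjE) simp_all
  qed
  then have "(\<Sum>k<n. s k * t1 k + s k * t2 k + s k * t3 k + s' k * t1 k + s' k * t2 k + s' k * t3 k) / n
    \<le> (\<Sum>k<n. 2 + s k * s' k + t1 k * t2 k + t1 k * t3 k + t2 k * t3 k) / n"
    by (rule divide_right_mono) simp
  then show ?thesis
    using n by (simp add: corr_def sum.distrib add_divide_distrib)
qed

text \<open>The right side is eight times the fraction of coordinates where the products of
  \<open>a\<close> with \<open>b\<close>, \<open>c\<close>, \<open>d\<close> are \<open>e1\<close>,
  \<open>e2\<close>, \<open>e3\<close>.\<close>

lemma corr_octant_nonneg:
  assumes s: "sign_vec n a" "sign_vec n b" "sign_vec n c" "sign_vec n d" and n: "n > 0"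
    and e: "e1 = 1 \<or> e1 = -1" "e2 = 1 \<or> e2 = -1" "e3 = 1 \<or> e3 = -1"
  shows "0 \<le> 1 + e1 * corr n a b + e2 * corr n a c + e3 * corr n a d
    + e1 * e2 * corr n b c + e1 * e3 * corr n b d + e2 * e3 * corr n c d
    + e1 * e2 * e3 * ((\<Sum>k<n. a k * b k * c k * d k) / n)"
proof -
  have "0 \<le> (\<Sum>k<n. 1 + e1 * (a k * b k) + e2 * (a k * c k) + e3 * (a k * d k)
    + e1 * e2 * (b k * c k) + e1 * e3 * (b k * d k) + e2 * e3 * (c k * d k)
    + e1 * e2 * e3 * (a k * b k * c k * d k))"
  proof (rule sum_nonneg)
    fix k assume "k \<in> {..<n}"
    then have "a k = 1 \<or> a k = -1" "b k = 1 \<or> b k = -1" "c k = 1 \<or> c k = -1" "d k = 1 \<or> d k = -1"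
      using s by (auto simp: sign_vec_def)
    then have "1 + e1 * (a k * b k) + e2 * (a k * c k) + e3 * (a k * d k)
      + e1 * e2 * (b k * c k) + e1 * e3 * (b k * d k) + e2 * e3 * (c k * d k)
      + e1 * e2 * e3 * (a k * b k * c k * d k)
      = (1 + e1 * (a k * b k)) * (1 + e2 * (a k * c k)) * (1 + e3 * (a k * d k))"
      by (elim disjE) (simp_all add: algebra_simps)
    also have "\<dots> \<ge> 0"
      using e \<open>a k = 1 \<or> a k = -1\<close> \<open>b k = 1 \<or> b k = -1\<close> \<open>c k = 1 \<or> c k = -1\<close> \<open>d k = 1 \<or> d k = -1\<close>
      by (intro mult_nonneg_nonneg) auto
    finally show "0 \<le> 1 + e1 * (a k * b k) + e2 * (a k * c k) + e3 * (a k * d k)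
      + e1 * e2 * (b k * c k) + e1 * e3 * (b k * d k) + e2 * e3 * (c k * d k)
      + e1 * e2 * e3 * (a k * b k * c k * d k)" .
  qed
  also have "\<dots> = real n + e1 * (\<Sum>k<n. a k * b k) + e2 * (\<Sum>k<n. a k * c k) + e3 * (\<Sum>k<n. a k * d k)
    + e1 * e2 * (\<Sum>k<n. b k * c k) + e1 * e3 * (\<Sum>k<n. b k * d k) + e2 * e3 * (\<Sum>k<n. c k * d k)
    + e1 * e2 * e3 * (\<Sum>k<n. a k * b k * c k * d k)"
    by (simp add: sum.distrib sum_distrib_left)
  finally show ?thesis
    using n by (simp add: corr_def add_divide_distrib[symmetric] zero_le_divide_iff field_simps)
qed

text \<open>The block fractions wi and block sums ui are recovered by Fourier inversion: the wi from
  the correlations among \<open>b\<close>, \<open>c\<close>, \<open>d\<close>, the ui from those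
  with \<open>a\<close> and the fourfold correlation \<open>T\<close>. The octant inequalities then
  say \<bar>ui\<bar> \<le> wi.\<close>

lemma corr_apex:
  fixes \<alpha> \<beta> r :: real
  assumes s: "sign_vec n a" "sign_vec n b" "sign_vec n c" "sign_vec n d" and n: "n > 0" and q: "even q"
    and ab: "\<alpha> \<ge> 0" "\<beta> \<ge> 0" "\<alpha> + \<beta> = 1"
    and r: "\<And>t. \<bar>t\<bar> \<le> 1 \<Longrightarrow> r \<le> \<alpha> * t + \<beta> * t^q"
    and K: "\<And>x y. K x y = \<alpha> * corr n x y + \<beta> * corr n x y ^ q"
  shows "K a b + K a c + K a d \<le> 1 - r + K b c + K b d + K c d"
proof -
  define T where "T = (\<Sum>k<n. a k * b k * c k * d k) / n"
  define B C G where BCG: "B = corr n a b" "C = corr n a c" "G = corr n a d"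
  define X Y Z where XYZ: "X = corr n c d" "Y = corr n b d" "Z = corr n b c"
  note o = corr_octant_nonneg[OF s n, folded T_def BCG XYZ]
  have "\<bar>(B + C + G + T) / 4\<bar> \<le> (1 + X + Y + Z) / 4"
    using o[of 1 1 1] o[of "-1" "-1" "-1"] by (simp add: abs_le_iff)
  moreover have "\<bar>(C + G - B - T) / 4\<bar> \<le> (1 + X - Y - Z) / 4"
    using o[of "-1" 1 1] o[of 1 "-1" "-1"] by (simp add: abs_le_iff)
  moreover have "\<bar>(B + G - C - T) / 4\<bar> \<le> (1 + Y - X - Z) / 4"
    using o[of 1 "-1" 1] o[of "-1" 1 "-1"] by (simp add: abs_le_iff)
  moreover have "\<bar>(B + C - G - T) / 4\<bar> \<le> (1 + Z - X - Y) / 4"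
    using o[of 1 1 "-1"] o[of "-1" "-1" 1] by (simp add: abs_le_iff)
  ultimately have bound: "\<alpha> * (apex_lin ((B + C + G + T) / 4) ((C + G - B - T) / 4) ((B + G - C - T) / 4) ((B + C - G - T) / 4)
      + 1 - 4 * ((1 + X + Y + Z) / 4))
    + \<beta> * (apex_pow q ((B + C + G + T) / 4) ((C + G - B - T) / 4) ((B + G - C - T) / 4) ((B + C - G - T) / 4)
      - apex_pow q (- ((1 + X + Y + Z) / 4)) ((1 + X - Y - Z) / 4) ((1 + Y - X - Z) / 4) ((1 + Z - X - Y) / 4)) \<le> 1 - r"
    by (intro apex_bound[OF _ q _ _ _ _ ab r]) (simp_all add: field_simps)
  have lin: "apex_lin ((B + C + G + T) / 4) ((C + G - B - T) / 4) ((B + G - C - T) / 4) ((B + C - G - T) / 4)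
      = B + C + G"
    by (simp add: apex_lin_def field_simps)
  have pow: "apex_pow q ((B + C + G + T) / 4) ((C + G - B - T) / 4) ((B + G - C - T) / 4) ((B + C - G - T) / 4)
      = B^q + C^q + G^q"
    unfolding apex_pow_def by (intro arg_cong2[where f = "(+)"] arg_cong[where f = "\<lambda>x. x^q"]) (simp_all add: field_simps)
  have pow': "apex_pow q (- ((1 + X + Y + Z) / 4)) ((1 + X - Y - Z) / 4) ((1 + Y - X - Z) / 4) ((1 + Z - X - Y) / 4)
      = X^q + Y^q + Z^q"
    unfolding apex_pow_def
    by (intro arg_cong2[where f = "(+)"] even_power_swap[OF q] disjI2) (simp_all add: field_simps)
  have "\<alpha> * (B + C + G - X - Y - Z) + \<beta> * (B^q + C^q + G^q - (X^q + Y^q + Z^q)) \<le> 1 - r"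
    using bound unfolding lin pow pow' by (simp add: add_divide_distrib algebra_simps)
  then show ?thesis
    unfolding K by (simp add: BCG[symmetric] XYZ[symmetric] algebra_simps)
qed

section \<open>Squared distances and the pentagonal inequalities\<close>

lemma sqdist_eq: "sqdist m x y = (\<Sum>k<m. (x k - y k)\<^sup>2)"
  by (simp add: sqdist_def vnorm_def L2_set_def sum_nonneg)

lemma sqdist_commute: "sqdist m x y = sqdist m y x"
  by (simp add: sqdist_eq power2_commute)

lemma sqdist_self [simp]: "sqdist m x x = 0"
  by (simp add: sqdist_eq)

text \<open>The premise \<open>pent\<close> also covers repeated vertices, which yields the triangle inequality.\<close>

lemma pentagonal_with_apex:
  fixes v :: "'a option \<Rightarrow> nat \<Rightarrow> real"
  assumes None: "\<And>i. sqdist m (v None) (v (Some i)) = D"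
    and pent: "\<And>s s' t1 t2 t3. e s s' + e t1 t2 + e t1 t3 + e t2 t3
      \<le> e s t1 + e s t2 + e s t3 + e s' t1 + e s' t2 + e s' t3"
    and apex: "\<And>a b c d. e b c + e b d + e c d \<le> 2 * D + e a b + e a c + e a d"
    and e: "\<And>i j. e i j = sqdist m (v (Some i)) (v (Some j))"
  shows "pentagonal m v I"
  unfolding pentagonal_def
proof (intro allI impI; elim conjE)
  fix S T :: "'a option set" assume "card S = 2" "card T = 3"
  then obtain s s' t1 t2 t3 where st: "S = {s, s'}" "s \<noteq> s'" "T = {t1, t2, t3}" "t1 \<noteq> t2" "t1 \<noteq> t3" "t2 \<noteq> t3"
    unfolding card_2_iff card_3_iff by blast
  define d where "d i j = sqdist m (v i) (v j)" for i j
  have d: "d i j = d j i" "d i i = 0" for i j by (simp_all add: d_def sqdist_commute)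
  have "pair_sum m v T = d t1 t2 + d t1 t3 + d t2 t3"
  proof -
    have "T - {t1} = {t2, t3}" "T - {t2} = {t1, t3}" "T - {t3} = {t1, t2}" using st by auto
    then show ?thesis
      using st(4-) d(1) by (simp add: pair_sum_def st(3) d_def[symmetric])
  qed
  moreover have "pair_sum m v S = d s s'"
    using st by (simp add: pair_sum_pair d_def)
  moreover have "(\<Sum>i\<in>S. \<Sum>j\<in>T. sqdist m (v i) (v j)) = d s t1 + d s t2 + d s t3 + d s' t1 + d s' t2 + d s' t3"
    using st by (simp add: d_def)
  moreover have "d s s' + d t1 t2 + d t1 t3 + d t2 t3 \<le> d s t1 + d s t2 + d s t3 + d s' t1 + d s' t2 + d s' t3"
  proof -
    have dN: "d None (Some i) = D" "d (Some i) None = D" for i using None d(1) by (auto simp: d_def)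
    have dS: "d (Some i) (Some j) = e i j" for i j by (simp add: d_def e)
    have ds: "e i j = e j i" "e i i = 0" for i j by (simp_all add: e sqdist_commute)
    have tri: "e b c \<le> e a b + e a c" for a b c
      using pent[of b a b b c] ds by simp
    \<comment> \<open>Half the sum of four triangle inequalities.\<close>
    have quad: "e a b + e x y \<le> e a x + e a y + e b x + e b y" for a b x y
      using tri[of a b x] tri[of a b y] tri[of x y a] tri[of x y b] ds(1)[of x a] ds(1)[of x b]
         ds(1)[of y a] ds(1)[of y b] by linarith
    \<comment> \<open>\<open>the None\<close> is an arbitrary value; it is not read when the index
      is the apex.\<close>
    obtain a b x y z where abxyz: "a = the s" "b = the s'" "x = the t1" "y = the t2" "z = the t3" by blast
    have "s = None \<or> s = Some a" "s' = None \<or> s' = Some b" "t1 = None \<or> t1 = Some x"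
      "t2 = None \<or> t2 = Some y" "t3 = None \<or> t3 = Some z"
      unfolding abxyz by (metis option.exhaust_sel)+
    \<comment> \<open>If the apex is in neither set, \<open>pent\<close> applies; if only in
      \<open>S\<close>, \<open>apex\<close>; if only in \<open>T\<close>, its distances cancel and
      leave \<open>quad\<close>; if in both, \<open>tri\<close> remains.\<close>
    moreover note pent[of a b x y z] apex[of x y z a] apex[of x y z b]
      tri[of x y a] tri[of x z a] tri[of y z a] tri[of x y b] tri[of x z b] tri[of y z b]
      quad[of a b x y] quad[of a b x z] quad[of a b y z]
      ds(1)[of x a] ds(1)[of y a] ds(1)[of z a] ds(1)[of x b] ds(1)[of y b] ds(1)[of z b]
    ultimately show ?thesis
      using st(2,4-) by (elim disjE) (simp_all add: dN dS d(2))
  qed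
  ultimately show "pair_sum m v S + pair_sum m v T \<le> (\<Sum>i\<in>S. \<Sum>j\<in>T. sqdist m (v i) (v j))" by simp
qed

lemma sum_lessThan_split3:
  fixes f :: "nat \<Rightarrow> real"
  shows "(\<Sum>k<1 + n + N. f k) = f 0 + (\<Sum>k<n. f (1 + k)) + (\<Sum>k<N. f (1 + n + k))"
proof -
  have split: "(\<Sum>k<a + b. f k) = (\<Sum>k<a. f k) + (\<Sum>k<b. f (a + k))" for a b
    using sum.atLeastLessThan_concat[of 0 a "a + b" f] sum.shift_bounds_nat_ivl[of f 0 a b]
    by (simp add: atLeast0LessThan add.commute)
  show ?thesis
    using split[of "1 + n" N] split[of 1 n] by simp
qed

lemma sum_sign_diff_square:
  assumes "sign_vec n x" "sign_vec n y" "n > 0"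
  shows "(\<Sum>k<n. (s * x k - s * y k)\<^sup>2) = s\<^sup>2 * (2 * n * (1 - corr n x y))"
proof -
  have "(\<Sum>k<n. (s * x k - s * y k)\<^sup>2) = (\<Sum>k<n. s\<^sup>2 * (2 - 2 * (x k * y k)))"
  proof (rule sum.cong[OF refl])
    fix k assume "k \<in> {..<n}"
    then have "x k = 1 \<or> x k = -1" "y k = 1 \<or> y k = -1"
      using assms by (auto simp: sign_vec_def)
    then show "(s * x k - s * y k)\<^sup>2 = s\<^sup>2 * (2 - 2 * (x k * y k))"
      by (elim disjE) (simp_all add: power2_eq_square)
  qed
  also have "\<dots> = s\<^sup>2 * (2 * n - 2 * (\<Sum>k<n. x k * y k))"
    by (simp add: sum_distrib_left[symmetric] sum_subtractf)
  finally show ?thesis using assms(3) by (simp add: corr_def algebra_simps)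
qed

lemma sum_sign_square:
  assumes "sign_vec n x"
  shows "(\<Sum>k<n. (s * x k)\<^sup>2) = s\<^sup>2 * n"
proof -
  have "(\<Sum>k<n. (s * x k)\<^sup>2) = (\<Sum>k<n. s\<^sup>2)"
    using assms by (intro sum.cong) (auto simp: sign_vec_def)
  then show ?thesis by simp
qed

text \<open>Coordinate 0 carries the inner product \<open>c\<close> with the apex; then come scaled
  copies of \<open>x i\<close> and \<open>y i\<close>, whose squared lengths share 1 - c^2 in
  proportion \<alpha> : \<beta>.\<close>

lemma sdp_vectors:
  fixes x y :: "'a \<Rightarrow> nat \<Rightarrow> real"
  assumes x: "\<And>i. sign_vec n (x i)" "n > 0" and y: "\<And>i. sign_vec N (y i)" "N > 0"
    and ab: "\<alpha> \<ge> 0" "\<beta> \<ge> 0" "\<alpha> + \<beta> = 1" and c: "\<bar>c\<bar> \<le> 1"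
  obtains m v where
    "vnorm m (v None) = 1" "\<And>i. vnorm m (v (Some i)) = 1"
    "\<And>i. sqdist m (v None) (v (Some i)) = 2 - 2 * c"
    "\<And>i j. sqdist m (v (Some i)) (v (Some j))
      = 2 * (1 - c\<^sup>2) * (1 - (\<alpha> * corr n (x i) (x j) + \<beta> * corr N (y i) (y j)))"
proof -
  have c2: "c\<^sup>2 \<le> 1" using c by (simp add: abs_square_le_1)
  define s t where st: "s = sqrt ((1 - c\<^sup>2) * \<alpha> / n)" "t = sqrt ((1 - c\<^sup>2) * \<beta> / N)"
  have s: "s\<^sup>2 * n = (1 - c\<^sup>2) * \<alpha>" and t: "t\<^sup>2 * N = (1 - c\<^sup>2) * \<beta>"
    using x(2) y(2) ab c2 by (simp_all add: st)
  define v where "v i k = (case i of None \<Rightarrow> of_bool (k = 0)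
    | Some i \<Rightarrow> if k = 0 then c else if k < 1 + n then s * x i (k - 1) else t * y i (k - (1 + n)))"
    for i k
  define m where "m = 1 + n + N"
  have N: "vnorm m (v None) = 1"
    unfolding vnorm_def L2_set_def m_def sum_lessThan_split3 by (simp add: v_def)
  have "(\<Sum>k<m. (v (Some i) k)\<^sup>2) = 1" for i
  proof -
    have "(\<Sum>k<m. (v (Some i) k)\<^sup>2) = c\<^sup>2 + s\<^sup>2 * n + t\<^sup>2 * N"
      unfolding m_def sum_lessThan_split3 using x y by (simp add: v_def sum_sign_square)
    also have "\<dots> = c\<^sup>2 + (1 - c\<^sup>2) * (\<alpha> + \<beta>)" unfolding s t by (simp add: algebra_simps)
    finally show ?thesis using ab(3) by simp
  qed
  note S = this
  then have S1: "vnorm m (v (Some i)) = 1" for i by (simp add: vnorm_def L2_set_def)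
  have d0: "sqdist m (v None) (v (Some i)) = 2 - 2 * c" for i
  proof -
    have "sqdist m (v None) (v (Some i)) = (1 - c)\<^sup>2 + s\<^sup>2 * n + t\<^sup>2 * N"
      unfolding sqdist_eq m_def sum_lessThan_split3 using x y by (simp add: v_def sum_sign_square)
    also have "\<dots> = (1 - c)\<^sup>2 + (1 - c\<^sup>2) * (\<alpha> + \<beta>)" unfolding s t by (simp add: algebra_simps)
    finally show ?thesis using ab(3) by (simp add: power2_eq_square algebra_simps)
  qed
  have d: "sqdist m (v (Some i)) (v (Some j))
      = 2 * (1 - c\<^sup>2) * (1 - (\<alpha> * corr n (x i) (x j) + \<beta> * corr N (y i) (y j)))" for i j
  proof -
    have "sqdist m (v (Some i)) (v (Some j)) =
      s\<^sup>2 * (2 * n * (1 - corr n (x i) (x j))) + t\<^sup>2 * (2 * N * (1 - corr N (y i) (y j)))"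
      unfolding sqdist_eq m_def sum_lessThan_split3 using x y by (simp add: v_def sum_sign_diff_square)
    also have "\<dots> = 2 * (s\<^sup>2 * n) * (1 - corr n (x i) (x j)) + 2 * (t\<^sup>2 * N) * (1 - corr N (y i) (y j))"
      by simp
    also have "\<dots> = 2 * (1 - c\<^sup>2) * ((\<alpha> + \<beta>) - (\<alpha> * corr n (x i) (x j) + \<beta> * corr N (y i) (y j)))"
      unfolding s t by (simp add: algebra_simps)
    finally show ?thesis using ab(3) by simp
  qed
  show thesis by (rule that[OF N S1 d0 d])
qed

lemma sdp_solution:
  fixes x :: "'a \<Rightarrow> nat \<Rightarrow> real" and \<alpha> \<beta> r :: real
  assumes x: "\<And>i. sign_vec n (x i)" and n: "n > 0" and q: "even q" "q > 0"
    and ab: "\<alpha> \<ge> 0" "\<beta> \<ge> 0" "\<alpha> + \<beta> = 1"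
    and r: "-1 < r" "\<And>t. \<bar>t\<bar> \<le> 1 \<Longrightarrow> r \<le> \<alpha> * t + \<beta> * t^q"
    and E: "\<And>i j. {i, j} \<in> E \<Longrightarrow> \<alpha> * corr n (x i) (x j) + \<beta> * corr n (x i) (x j) ^ q = r"
  obtains m v where "feasible V E m v" "objective V m v = card V / (1 - r)"
proof -
  obtain N and y :: "'a \<Rightarrow> nat \<Rightarrow> real" where N: "N > 0" and y: "\<And>i. sign_vec N (y i)"
    and xy: "\<And>i j. corr N (y i) (y j) = corr n (x i) (x j) ^ q"
    using corr_power[of n x q] n x by blast
  \<comment> \<open>The kernel is 0 at 0.\<close>
  have r0: "r \<le> 0" using r(2)[of 0] q by (simp add: power_0_left)
  \<comment> \<open>this c = v0 . vi makes the edge constraint tight exactly at the minimal kernel value r\<close>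
  define c where "c = (1 + r) / (1 - r)"
  have c: "0 \<le> c" "c \<le> 1" using r0 r(1) by (simp_all add: c_def divide_le_eq)
  define g where "g = 2 * (1 - c\<^sup>2)"
  define D where "D = 2 - 2 * c"
  have g0: "g \<ge> 0" using c by (simp add: g_def abs_square_le_1)
  \<comment> \<open>An edge has kernel value \<open>r\<close>, so this is its constraint; it also
    rescales \<open>corr_apex\<close> to distances.\<close>
  have gD: "g * (1 - r) = 2 * D"
  proof -
    have "c * (1 - r) = 1 + r" using r0 by (simp add: c_def)
    then have "(1 + c) * (1 - r) = 2" by (simp add: algebra_simps)
    moreover have "g * (1 - r) = 2 * (1 - c) * ((1 + c) * (1 - r))"
      by (simp add: g_def power2_eq_square algebra_simps)
    ultimately show ?thesis by (simp add: D_def)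
  qed
  obtain m v where v: "vnorm m (v None) = 1" "\<And>i. vnorm m (v (Some i)) = 1"
    "\<And>i. sqdist m (v None) (v (Some i)) = D"
    "\<And>i j. sqdist m (v (Some i)) (v (Some j))
      = g * (1 - (\<alpha> * corr n (x i) (x j) + \<beta> * corr N (y i) (y j)))"
    unfolding D_def g_def using sdp_vectors[of n x N y \<alpha> \<beta> c] x n y N ab c by (metis abs_of_nonneg)
  define K where "K i j = \<alpha> * corr n (x i) (x j) + \<beta> * corr n (x i) (x j) ^ q" for i j
  have vK: "sqdist m (v (Some i)) (v (Some j)) = g * (1 - K i j)" for i j
    by (simp add: v(4) xy K_def)
  have "pentagonal m v (indices V)"
  proof (rule pentagonal_with_apex[OF v(3) _ _ vK[symmetric]])
    fix s s' t1 t2 t3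
    \<comment> \<open>The inequality holds for the sign vectors \<open>x\<close> and
      \<open>y\<close> separately and is mixed with weights \<alpha> and \<beta>.\<close>
    have "K s t1 + K s t2 + K s t3 + K s' t1 + K s' t2 + K s' t3
      = \<alpha> * (corr n (x s) (x t1) + corr n (x s) (x t2) + corr n (x s) (x t3) + corr n (x s') (x t1)
          + corr n (x s') (x t2) + corr n (x s') (x t3))
      + \<beta> * (corr N (y s) (y t1) + corr N (y s) (y t2) + corr N (y s) (y t3) + corr N (y s') (y t1)
          + corr N (y s') (y t2) + corr N (y s') (y t3))"
      by (simp add: K_def xy algebra_simps)
    also have "\<dots> \<le> \<alpha> * (2 + corr n (x s) (x s') + corr n (x t1) (x t2) + corr n (x t1) (x t3) + corr n (x t2) (x t3))
      + \<beta> * (2 + corr N (y s) (y s') + corr N (y t1) (y t2) + corr N (y t1) (y t3) + corr N (y t2) (y t3))"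
      using ab x y n N by (intro add_mono mult_left_mono corr_pentagonal) auto
    also have "\<dots> = 2 * (\<alpha> + \<beta>) + K s s' + K t1 t2 + K t1 t3 + K t2 t3"
      unfolding K_def xy by (simp add: algebra_simps)
    finally have "g * (K s t1 + K s t2 + K s t3 + K s' t1 + K s' t2 + K s' t3)
      \<le> g * (2 + K s s' + K t1 t2 + K t1 t3 + K t2 t3)"
      using g0 ab(3) by (intro mult_left_mono) auto
    then show "g * (1 - K s s') + g * (1 - K t1 t2) + g * (1 - K t1 t3) + g * (1 - K t2 t3)
      \<le> g * (1 - K s t1) + g * (1 - K s t2) + g * (1 - K s t3)
        + g * (1 - K s' t1) + g * (1 - K s' t2) + g * (1 - K s' t3)"
      by (simp add: algebra_simps)
  next
    fix a b c d
    have "K a b + K a c + K a d \<le> 1 - r + K b c + K b d + K c d"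
      unfolding K_def
      by (rule corr_apex[OF x x x x n q(1) ab r(2), where K = "\<lambda>x y. \<alpha> * corr n x y + \<beta> * corr n x y ^ q"]) auto
    then have "g * (K a b + K a c + K a d) \<le> g * (1 - r + K b c + K b d + K c d)"
      using g0 by (rule mult_left_mono)
    also have "\<dots> = 2 * D + g * (K b c + K b d + K c d)"
      using gD by (simp add: algebra_simps)
    finally show "g * (1 - K b c) + g * (1 - K b d) + g * (1 - K c d)
      \<le> 2 * D + g * (1 - K a b) + g * (1 - K a c) + g * (1 - K a d)"
      by (simp add: algebra_simps)
  qed
  moreover have "sqdist m (v (Some i)) (v None) + sqdist m (v (Some j)) (v None)
      = sqdist m (v (Some i)) (v (Some j))" if "{i, j} \<in> E" for i j
    using E[OF that] gD v(3) by (simp add: vK K_def sqdist_commute[of m "v (Some _)" "v None"])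
  ultimately have "feasible V E m v"
    using v(1,2) by (auto simp: feasible_def indices_def)
  moreover have "objective V m v = card V / (1 - r)"
  proof -
    have "1 - D / 4 = 1 / (1 - r)"
      using r0 by (simp add: D_def c_def field_simps)
    then show ?thesis by (simp add: objective_def v(3))
  qed
  ultimately show thesis by (rule that)
qed

section \<open>Lower bounds for the program and for vertex covers\<close>

lemma OPT_ge_1:
  assumes "finite V" "{i, j} \<in> E" "i \<noteq> j" "i \<in> V" "j \<in> V"
  shows "1 \<le> OPT V E"
  unfolding OPT_def
proof (rule cInf_greatest[OF OPT_nonempty])
  fix z assume "z \<in> {objective V m v | m v. feasible V E m v}"
  then obtain m v where z: "z = objective V m v" and f: "feasible V E m v" by blast
  have n: "vnorm m (v k) = 1" if "k \<in> indices V" for k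
    using f that by (simp add: feasible_def)
  let ?t = "\<lambda>i. 1 - sqdist m (v None) (v (Some i)) / 4"
  have nonneg: "?t k \<ge> 0" if "k \<in> V" for k
    using sqdist_le_4[OF n n, of None "Some k"] that by (simp add: indices_def)
  \<comment> \<open>The edge constraint turns the sum into the squared distance of two unit
    vectors.\<close>
  have "sqdist m (v None) (v (Some i)) + sqdist m (v None) (v (Some j)) \<le> 4"
    using f assms(2) sqdist_le_4[OF n n, of "Some i" "Some j"] assms(4,5)
    by (simp add: feasible_def indices_def sqdist_commute[of m "v None"])
  then have "1 \<le> (\<Sum>k\<in>{i, j}. ?t k)" using assms(3) by simp
  also have "\<dots> \<le> (\<Sum>k\<in>V. ?t k)"
    using assms nonneg by (intro sum_mono2) auto
  finally show "1 \<le> z" by (simp add: z objective_def)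
qed

text \<open>The complement of a cover contains no edge.\<close>

lemma vc_lower_bound:
  assumes "finite_graph V E"
    and "\<And>I. I \<subseteq> V \<Longrightarrow> (\<And>e. e \<in> E \<Longrightarrow> \<not> e \<subseteq> I) \<Longrightarrow> real (card I) \<le> M"
  shows "real (card V) - M \<le> real (vc V E)"
proof -
  have "vc V E \<in> {card C | C. vertex_cover V E C}"
    unfolding vc_def using vc_wf[OF assms(1)] by (rule Min_in)
  then obtain C where C: "vc V E = card C" "vertex_cover V E C" by blast
  have fin: "finite V" using assms(1) by (simp add: finite_graph_def)
  have "real (card (V - C)) \<le> M"
    using C(2) by (intro assms(2)) (auto simp: vertex_cover_def)
  moreover have "card (V - C) = card V - card C" "card C \<le> card V"
    using C(2) fin by (auto simp: vertex_cover_def card_Diff_subset finite_subset card_mono)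
  ultimately show ?thesis using C(1) by simp
qed

subsection \<open>The gap\<close>

lemma corr_indicators:
  assumes "a \<subseteq> {..<n}" "b \<subseteq> {..<n}" "n > 0"
  shows "corr n (\<lambda>k. if k \<in> a then 1 else -1) (\<lambda>k. if k \<in> b then 1 else -1)
    = 1 - 2 * real (card (sym_diff a b)) / n"
proof -
  define c where "c = sym_diff a b"
  have c: "{..<n} \<inter> c = c" using assms by (auto simp: c_def)
  have "(\<Sum>k<n. (if k \<in> a then 1 else -1) * (if k \<in> b then 1 else -1))
    = (\<Sum>k<n. 1 - 2 * (of_bool (k \<in> c) :: real))"
    by (intro sum.cong) (auto simp: c_def)
  also have "\<dots> = n - 2 * real (card c)"
    by (simp add: sum_subtractf sum_distrib_left[symmetric] c)
  finally show ?thesis using assms(3) by (simp add: corr_def diff_divide_distrib c_def)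
qed

lemma even_card_sym_diff:
  assumes "finite a" "finite b"
  shows "even (card (sym_diff a b)) \<longleftrightarrow> even (card a + card b)"
proof -
  have "card a = card (a - b) + card (a \<inter> b)" "card b = card (b - a) + card (a \<inter> b)"
    using assms by (metis card_Diff_subset_Int card_Int_Diff inf_commute add.commute)+
  moreover have "card (sym_diff a b) = card (a - b) + card (b - a)"
    using assms by (intro card_Un_disjoint) auto
  ultimately show ?thesis by presburger
qed

text \<open>Distances of distinct members are even, positive and below 4p, so with \<open>p\<close>
  odd the only possible multiple of \<open>p\<close> is the excluded 2p. Chebyshev then applies with
  \<open>n - 2 * p = 2 * h\<close>.\<close>

lemma forbidden_distance_bound:
  fixes p h :: nat
  assumes p: "prime p" "odd p" and h: "0 < h" "h < p" and n: "n = 2 * p + 2 * h"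
    and A: "A \<subseteq> {T. T \<subseteq> {..<n} \<and> even (card T)}"
    and dist: "\<And>a b. a \<in> A \<Longrightarrow> b \<in> A \<Longrightarrow> card (sym_diff a b) \<noteq> 2 * p"
  shows "real (card A) * (2 * (real h)\<^sup>2) \<le> real (p + h) * 2 ^ n"
proof -
  have "card A \<le> card {T. T \<subseteq> {..<n} \<and> card T < p}"
  proof (rule modular_frankl_wilson[OF p(1)])
    fix a b assume ab: "a \<in> A" "b \<in> A" "a \<noteq> b"
    then have sub: "a \<subseteq> {..<n}" "b \<subseteq> {..<n}" using A by auto
    then have fin: "finite a" "finite b" by (auto intro: finite_subset)
    have ev: "even (card (sym_diff a b))"
      using ab A even_card_sym_diff[OF fin] by auto
    have "card (sym_diff a b) \<le> card {..<n}"
      using sub by (intro card_mono) auto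
    then have lt: "card (sym_diff a b) < 4 * p" using h n by simp
    have pos: "card (sym_diff a b) > 0" using ab(3) fin by (auto simp: card_gt_0_iff)
    show "\<not> p dvd card (sym_diff a b)"
    proof
      assume "p dvd card (sym_diff a b)"
      then obtain k where k: "card (sym_diff a b) = p * k" by (elim dvdE)
      then have "k < 4" "k > 0" "even k" using lt pos ev p(2) by auto
      then have "k = 2" by presburger
      then show False using dist[OF ab(1,2)] k by simp
    qed
  qed (use A in auto)
  then have "real (card A) * (2 * real h)\<^sup>2 \<le> real (card {T. T \<subseteq> {..<n} \<and> card T < p}) * (2 * real h)\<^sup>2"
    by (intro mult_right_mono) auto
  also have "\<dots> \<le> real n * 2 ^ n"
    using card_few_elements_bound[of p n] by (simp add: n)
  also have "\<dots> = 2 * (real (p + h) * 2 ^ n)"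
    using n by simp
  also have "real (card A) * (2 * real h)\<^sup>2 = 2 * (real (card A) * (2 * (real h)\<^sup>2))"
    by (simp add: power_mult_distrib)
  finally show ?thesis by simp
qed

text \<open>\<open>h\<close> is a fixed fraction of \<open>p\<close>: small enough for edges to be
  nearly antipodal, as the kernel requires, yet with \<open>h^2\<close> dominating
  \<open>p + h\<close> in Chebyshev's bound.\<close>

lemma prime_parameters:
  fixes \<epsilon> :: real and q :: nat
  assumes \<epsilon>: "\<epsilon> > 0" and q: "q > 0"
  obtains p h :: nat where "prime p" "odd p" "0 < h" "h < p" "4 * q * h \<le> p"
    "4 * real (p + h) \<le> \<epsilon> * (real h)\<^sup>2"
proof -
  define K where "K = 4 * q"
  have K: "K \<ge> 4" using q by (simp add: K_def)
  \<comment> \<open>From p at least 2K, rounding costs at most a factor 2, so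
    \<open>p \<le> 2 * K * h\<close>. Then \<epsilon> h^2 is at least \<epsilon> p^2 / (4 K^2), and
    the constant 32 makes this at least 8p.\<close>
  obtain p where p: "prime p" "p > nat \<lceil>32 * (real K)\<^sup>2 / \<epsilon>\<rceil> + 2 * K + 3"
    using bigger_prime by blast
  define h where "h = p div K"
  have hK: "K * h \<le> p" by (simp add: h_def)
  have "p < K * (h + 1)"
    unfolding h_def using K by (metis Suc_eq_plus1 dividend_less_times_div mult_Suc_right add.commute not_less_eq_eq numeral_eq_Suc zero_less_Suc le_less_trans not_le)
  then have "real p < K * (h + 1)" by (metis of_nat_less_iff)
  moreover have "real p \<ge> 2 * K" using p(2) by linarith
  ultimately have ph: "real p \<le> 2 * K * h" by (simp add: algebra_simps)
  have p0: "real p > 0" using p(2) by simp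
  have h0: "h > 0" using ph p0 by (cases "h = 0") auto
  have "4 * h \<le> K * h" using K by simp
  then have hp: "h < p" using hK h0 by linarith
  have "32 * (real K)\<^sup>2 / \<epsilon> \<le> p" using p(2) by linarith
  then have "32 * (real K)\<^sup>2 \<le> \<epsilon> * p" using \<epsilon> by (simp add: field_simps)
  then have "32 * (real K)\<^sup>2 * p \<le> \<epsilon> * p * p" using p0 by (intro mult_right_mono) auto
  also have "\<dots> = \<epsilon> * (real p)\<^sup>2" by (simp add: power2_eq_square)
  also have "\<dots> \<le> \<epsilon> * (2 * K * h)\<^sup>2"
    using \<epsilon> ph p0 by (intro mult_left_mono power_mono) auto
  also have "\<dots> = 4 * (real K)\<^sup>2 * (\<epsilon> * (real h)\<^sup>2)" by (simp add: power_mult_distrib)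
  finally have "4 * (real K)\<^sup>2 * (8 * p) \<le> 4 * (real K)\<^sup>2 * (\<epsilon> * (real h)\<^sup>2)" by simp
  then have "8 * real p \<le> \<epsilon> * (real h)\<^sup>2" using K by (subst (asm) mult_le_cancel_left_pos) auto
  then have "4 * real (p + h) \<le> \<epsilon> * (real h)\<^sup>2" using hp by simp
  moreover have "odd p" using p by (intro prime_odd_nat) auto
  ultimately show thesis using that[of p h] p(1) h0 hp hK by (simp add: K_def)
qed

lemma integrality_gap:
  fixes \<epsilon> :: real
  assumes \<epsilon>: "0 < \<epsilon>" "\<epsilon> \<le> 1"
  shows "\<exists>(V :: nat set) (E :: nat set set).
    finite_graph V E \<and> 1 \<le> OPT V E \<and> real (vc V E) \<ge> (2 - \<epsilon>) * OPT V E"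
proof -
  \<comment> \<open>Doubling makes \<open>q\<close> even; the size gives
    \<open>5 / q \<le> \<epsilon> / 2\<close>.\<close>
  define q where "q = 2 * nat \<lceil>10 / \<epsilon>\<rceil>"
  have "10 / \<epsilon> > 0" using \<epsilon> by simp
  then have q: "even q" "q > 0" "real q \<ge> 10 / \<epsilon>" unfolding q_def by (simp, linarith, linarith)
  obtain p h :: nat where p: "prime p" "odd p" and h: "0 < h" "h < p" "4 * q * h \<le> p"
    and ph: "4 * real (p + h) \<le> \<epsilon> * (real h)\<^sup>2"
    using prime_parameters[OF \<epsilon>(1) q(2)] by blast
  define n where "n = 2 * p + 2 * h"
  have n: "n > 0" using h by (simp add: n_def)
  \<comment> \<open>An edge at distance 2p out of n has correlation 1 - 4p/n = -m.\<close>
  define m where "m = (real p - h) / (p + h)"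
  have m1: "1 - m = 2 * h / (p + h)" using h by (simp add: m_def field_simps)
  have m: "0 < m" "m < 1" using h by (auto simp: m_def)
  have "2 * real q * (1 - m) = 4 * q * h / real (p + h)" by (simp add: m1)
  also have "\<dots> \<le> 1"
  proof -
    have "real (4 * q * h) \<le> real p" using h(3) by (rule of_nat_mono)
    then show ?thesis using h by (simp add: divide_le_eq)
  qed
  finally have mq: "2 * real q * (1 - m) \<le> 1" .
  define \<beta> where "\<beta> = 1 / (1 + q * m ^ (q - 1))"
  define r where "r = (1 - \<beta>) * (- m) + \<beta> * (- m) ^ q"
  note min = kernel_min[OF q(1,2) m(1) \<beta>_def, folded r_def]
  note val = kernel_min_value[OF q(1,2) m mq \<beta>_def, folded r_def]
  have "5 / q \<le> \<epsilon> / 2" using q(2,3) \<epsilon> by (simp add: field_simps)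
  then have r: "r \<le> \<epsilon> / 2 - 1" using val(3) by linarith

  define \<A> where "\<A> = {T. T \<subseteq> {..<n} \<and> even (card T)}"
  have fin: "finite \<A>" by (rule finite_subset[of _ "Pow {..<n}"]) (auto simp: \<A>_def)
  \<comment> \<open>The even sets are numbered, to obtain a graph on natural numbers.\<close>
  define V where "V = {0..<card \<A>}"
  obtain s where s: "bij_betw s V \<A>"
    unfolding V_def using ex_bij_betw_nat_finite[OF fin] by blast
  have V: "finite V" "card V = card \<A>" by (simp_all add: V_def)
  define E where "E = {{i, j} | i j. i \<in> V \<and> j \<in> V \<and> card (sym_diff (s i) (s j)) = 2 * p}"
  have p0: "p > 0" using h by simp
  have E: "i \<in> V" "j \<in> V" "card (sym_diff (s i) (s j)) = 2 * p" if ij: "{i, j} \<in> E" for i j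
    using that by (auto simp: E_def doubleton_eq_iff Un_commute)
  have E2: "i \<noteq> j" if "{i, j} \<in> E" for i j
    using E(3)[OF that] p0 by auto
  have G: "finite_graph V E"
    unfolding finite_graph_def
  proof (intro conjI ballI)
    fix e assume "e \<in> E"
    moreover then obtain i j where "e = {i, j}" by (auto simp: E_def)
    ultimately show "e \<subseteq> V" "card e = 2" using E E2 by auto
  qed (rule V)
  have sV: "s i \<subseteq> {..<n}" if "i \<in> V" for i
    using s that by (auto simp: bij_betw_def \<A>_def)

  define x where "x i k = (if k \<in> s i then 1 else -1 :: real)" for i :: nat and k :: nat
  have "corr n (x i) (x j) = - m" if "{i, j} \<in> E" for i j
  proof -
    have "corr n (x i) (x j) = 1 - 2 * real (2 * p) / n"
      unfolding x_def using corr_indicators[OF sV sV n, of i j] E[OF that] by simp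
    also have "\<dots> = - m" using h by (simp add: m_def n_def field_simps)
    finally show ?thesis .
  qed
  then obtain M v where v: "feasible V E M v" "objective V M v = card V / (1 - r)"
    using val(1,2,4) min q n
    by (elim sdp_solution[of n x q "1 - \<beta>" \<beta> r E V, rotated -1]) (auto simp: sign_vec_def x_def r_def)
  have "OPT V E \<le> card V / (1 - r)"
    unfolding OPT_def using v by (intro cInf_lower2[OF _ _ OPT_bdd_below]) auto
  also have "\<dots> \<le> card V / (2 - \<epsilon> / 2)"
    using r \<epsilon> by (intro divide_left_mono) auto
  finally have opt: "OPT V E \<le> card V / (2 - \<epsilon> / 2)" .

  have cV: "2 * real (card V) = 2 ^ n"
    using card_even_subsets[OF n] V by (metis \<A>_def of_nat_mult of_nat_numeral of_nat_power)
  have "real (card V) - \<epsilon> / 4 * card V \<le> vc V E"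
  proof (rule vc_lower_bound[OF G])
    fix I assume I: "I \<subseteq> V" "\<And>e. e \<in> E \<Longrightarrow> \<not> e \<subseteq> I"
    have inj: "inj_on s I" using s I(1) by (meson bij_betw_def inj_on_subset)
    have "real (card (s ` I)) * (2 * (real h)\<^sup>2) \<le> real (p + h) * 2 ^ n"
    proof (rule forbidden_distance_bound[OF p h(1,2) n_def])
      show "s ` I \<subseteq> {T. T \<subseteq> {..<n} \<and> even (card T)}"
        using s I(1) by (auto simp: bij_betw_def \<A>_def)
      fix a b assume "a \<in> s ` I" "b \<in> s ` I"
      then obtain i j where ij: "i \<in> I" "j \<in> I" "a = s i" "b = s j" by blast
      then show "card (sym_diff a b) \<noteq> 2 * p"
        using I(2)[of "{i, j}"] I(1) by (auto simp: E_def)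
    qed
    also have "\<dots> = 2 * real (p + h) * card V" by (simp add: cV[symmetric])
    also have "\<dots> \<le> (\<epsilon> * (real h)\<^sup>2 / 2) * card V"
      using ph by (intro mult_right_mono) auto
    finally have "(2 * (real h)\<^sup>2) * card I \<le> (2 * (real h)\<^sup>2) * (\<epsilon> / 4 * card V)"
      using inj by (simp add: card_image mult_ac)
    then show "real (card I) \<le> \<epsilon> / 4 * card V"
      using h by (subst (asm) mult_le_cancel_left_pos) auto
  qed
  moreover have "(2 - \<epsilon>) * OPT V E \<le> card V - \<epsilon> / 4 * card V"
  proof -
    have "(2 - \<epsilon>) * OPT V E \<le> (2 - \<epsilon>) * (card V / (2 - \<epsilon> / 2))"
      using opt \<epsilon> by (intro mult_left_mono) auto
    also have "\<dots> = card V * ((2 - \<epsilon>) / (2 - \<epsilon> / 2))" by simp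
    \<comment> \<open>Indeed 2 (1 - \<epsilon>/4)^2 is at least 2 - \<epsilon>.\<close>
    also have "\<dots> \<le> card V * (1 - \<epsilon> / 4)"
      using \<epsilon> by (intro mult_left_mono) (auto simp: field_simps)
    finally show ?thesis by (simp add: algebra_simps)
  qed
  moreover have "1 \<le> OPT V E"
  proof -
    \<comment> \<open>These two sets form an edge.\<close>
    have "{} \<in> \<A>" "{..<2 * p} \<in> \<A>" by (auto simp: \<A>_def n_def)
    then obtain i j where ij: "i \<in> V" "j \<in> V" "s i = {}" "s j = {..<2 * p}"
      using s by (metis bij_betw_def imageE)
    then have "card (sym_diff (s i) (s j)) = 2 * p" by simp
    then have "{i, j} \<in> E" unfolding E_def using ij by blast
    from OPT_ge_1[OF V(1) this E2[OF this] ij(1,2)] show ?thesis .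
  qed
  ultimately show ?thesis using G by (intro exI[of _ V] exI[of _ E]) simp
qed

theorem theorem5:
  fixes \<epsilon> :: real
  assumes "\<epsilon> > 0"
  shows "\<exists>(V :: nat set) (E :: nat set set).
    finite_graph V E \<and> OPT V E > 0 \<and> real (vc V E) \<ge> (2 - \<epsilon>) * OPT V E"
proof -
  \<comment> \<open>Since \<open>OPT\<close> is nonnegative, a smaller \<epsilon> gives a stronger
    inequality, so \<epsilon> may be capped at 1.\<close>
  obtain V :: "nat set" and E where G: "finite_graph V E" "1 \<le> OPT V E"
    and gap: "(2 - min \<epsilon> 1) * OPT V E \<le> real (vc V E)"
    using integrality_gap[of "min \<epsilon> 1"] assms by auto
  have "(2 - \<epsilon>) * OPT V E \<le> (2 - min \<epsilon> 1) * OPT V E"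
    using G by (intro mult_right_mono) auto
  also note gap
  finally show ?thesis using G by (intro exI[of _ V] exI[of _ E]) simp
qed

end
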